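(* Let $H$ be an abelian group, let $T_0$ be a based matrix with coefficients in $H$, let $\mathfrak C$ be a tribal system defined on the based matrices homologous to $T_0$, and let $T_\bullet=(G_\bullet,s,b_\bullet)$ be a chosen primitive based matrix homologous to $T_0$. With the groups $\bar A^{\mathfrak C}(T)$, maps $\bar P^{\mathfrak C}_T$ and homomorphisms $\bar A^{\mathfrak C}(f)$ defined in the context: 1. Let $T=(G,s,b)$ be a based matrix homologous to $T_\bullet$ and let $f\colon T\to T_\bullet$ be a chain of operations $M_i^{\pm1}$ $(i=1,2,3)$ connecting these based matrices. Then the map $\bar A^{\mathfrak C}(f)\colon \bar A^{\mathfrak C}(T)\to \bar A^{\mathfrak C}(T_\bullet)$ is an isomorphism which does not depend on the choice of the chain $f$. 2. The family of maps $\bar p^{\mathfrak C}_T=\bar A^{\mathfrak C}(f)\circ \bar P^{\mathfrak C}_T\colon G\to \bar A^{\mathfrak C}(T_\bullet)$, where $T=(G,s,b)$ ranges over the based matrices homologous to $T_\bullet$ and $f\colon T\to T_\bullet$ is any chain as in 1, is a parity (on the based matrices homologous to $T_0$) with coefficients in $\bar A^{\mathfrak C}(T_\bullet)$.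
   Context: **Based matrices.** Let $H$ be an abelian group. A based matrix with coefficients in $H$ is a triple $T=(G,s,b)$ with $G$ a finite set, $s\in G$, and $b\colon G\times G\to H$ skew-symmetric: $b(h,g)=-b(g,h)$ for all $g,h\in G$, and $b(s,s)=0$. Put $G^\circ=G\setminus\{s\}$. Extend $b$ biadditively to $\mathbb Z[G]$, and for $C\subset G$ put $\chi_C=\sum_{g\in C}g$. An element $g\in G^\circ$ is annihilating if $b(g,h)=0$ for all $h\in G$, and core if $b(g,h)=b(s,h)$ for all $h\in G$. Two elements $g_1,g_2\in G^\circ$ are complementary if $b(g_1,h)+b(g_2,h)=b(s,h)$ for all $h\in G$. **Operations.** Operation $M_1$ (resp. $M_2$) replaces $(G,s,b)$ by $(G\sqcup\{g\},s,b')$ with $b'$ extending $b$ and $g$ annihilating (resp. core). Operation $M_3$ replaces it by $(G\sqcup\{g,g'\},s,b')$ with $b'$ any skew-symmetric extension of $b$ for which $g,g'$ are complementary. Two based matrices are homologous if they are connected by a finite sequence of the operations $M_i^{\pm1}$. A based matrix is primitive if it has no annihilating element, no core element and no pair of complementary elements. (Known: every based matrix is homologous to a primitive one, unique up to isomorphism.) An automorphism of $T$ is a bijection of $G$ fixing $s$ and preserving $b$; $Aut(T)$ is the group of automorphisms. **Parity.** A parity with coefficients in an abelian group $A$ is a family of maps $p_T\colon G\to A$, one for each based matrix $T=(G,s,b)$ in the class considered, with $p_T(s)=0$ and such that: (P0) if $T'$ is obtained from $T=(G,s,b)$ by $M_1$, $M_2$ or $M_3$, then $p_{T'}(g)=p_T(g)$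 for all $g\in G$; (P1) $p_T(g)=0$ if $g$ is annihilating or core; (P2) $p_T(g_1)+p_T(g_2)=0$ if $g_1,g_2$ are complementary; (P3) if $g_1,g_2,g_3\in G^\circ$ satisfy $b(g_1,h)+b(g_2,h)+b(g_3,h)=b(s,h)$ for all $h\in G$, then $p_T(g_1)+p_T(g_2)+p_T(g_3)=0$. **Tribal systems.** A tribal system is a family of partitions $\mathfrak C(T)$ of the sets $G$, for $T=(G,s,b)$ in the class considered, such that (i) $\{s\}\in\mathfrak C(T)$; (ii) if $T'$ is obtained from $T=(G,s,b)$ by $M_1,M_2$ or $M_3$, then $\mathfrak C(T)=\mathfrak C(T')\cap G$, i.e. for any $C\in\mathfrak C(T)$ there is a unique $C'\in\mathfrak C(T')$ with $C=C'\cap G$, and $\mathfrak C(T)$ consists of the nonempty sets $C'\cap G$; (iii) complementary elements of $T$ lie in the same class of $\mathfrak C(T)$. The classes are called tribes. **Primitive tribes and zero tribe.** A tribe $C\in\mathfrak C(T)$ is primitive if it meets the underlying set of a primitive based matrix obtained from $T$ by successively deleting annihilating elements, core elements and complementary pairs (this does not depend on the choice of that primitive matrix); $\mathfrak C(T)_{prim}$ is the set of primitive tribes. If $T'$ is obtained from $T=(G,s,b)$ by $M_1,M_2$ or $M_3$, then $C'\mapsto C'\cap G$ is a bijection $\mathfrak C(T')_{prim}\to\mathfrak C(T)_{prim}$. The zero tribe $C_0(T)$ is defined as follows: adjoin to $T$ an annihilating element $g'$ (operation $M_1$) and put $C_0(T)=C'\cap G$, where $C'$ is the tribe containing $g'$;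 it contains all annihilating and core elements of $T$, and may be empty. **The partition $\bar{\mathfrak C}$.** For the primitive matrix $T_\bullet$ all tribes are primitive. Let $\bar{\mathfrak C}(T_\bullet)$ be the finest partition of $G_\bullet$ such that each of its classes is a union of tribes of $\mathfrak C(T_\bullet)$ and each of its classes $\bar C$ satisfies $\phi(\bar C)=\bar C$ for all $\phi\in Aut(T_\bullet)$. It induces a partition of the set of tribes $\mathfrak C(T_\bullet)_{prim}$. For any $T$ homologous to $T_\bullet$, transport this partition to $\mathfrak C(T)_{prim}$ along a chain of operations $M_i^{\pm1}$ from $T$ to $T_\bullet$, using for each operation $M_i$ $(i=1,2,3)$ from a based matrix $T_1=(G_1,s,b_1)$ to a based matrix $T_2$ the bijection $\mathfrak C(T_2)_{prim}\to\mathfrak C(T_1)_{prim}$, $C'\mapsto C'\cap G_1$, between primitive tribes, or its inverse (the result does not depend on the chain). Let $\bar{\mathfrak C}(T)_{prim}$ be the set of the resulting classes, each class $\bar C$ being regarded as a subset of $G$ (the union of the primitive tribes in it). Put $\bar{\mathfrak C}(T)^*_{prim}=\bar{\mathfrak C}(T)_{prim}\setminus\{\bar C_0(T)\}$, where $\bar C_0(T)$ is the class containing the zero tribe $C_0(T)$ if $C_0(T)$ is primitive, and $\bar C_0(T)=\emptyset$ (nothing is removed) otherwise. **Groups and maps.** $H[X]$ denotes the group of finite formal sums of elements of the set $X$ with coefficients in $H$, and $\langle x\rangle$ the cyclic subgroup generated by $x$. Let $$\bar A^{\mathfrak C}(T)=H[\bar{\mathfrak C}(T)^*_{prim}]/\langle\bar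 b(s)\rangle,\qquad \bar b(s)=\sum_{\bar C\in\bar{\mathfrak C}(T)^*_{prim}}b(s,\chi_{\bar C})\cdot\bar C,$$ and define $\bar P^{\mathfrak C}_T\colon G\to\bar A^{\mathfrak C}(T)$ by $$\bar P^{\mathfrak C}_T(g)=\sum_{\bar C\in\bar{\mathfrak C}(T)^*_{prim}}\left(b(g,\chi_{\bar C})-\left\lfloor\tfrac{|\bar C|}{2}\right\rfloor b(g,s)\right)\cdot\bar C .$$ For an operation $f\colon T\to T'$ of type $M_1,M_2$ or $M_3$, $T=(G,s,b)$, define $\bar A^{\mathfrak C}(f)\colon\bar A^{\mathfrak C}(T)\to\bar A^{\mathfrak C}(T')$ by $\sum\lambda_{\bar C}\cdot\bar C\mapsto\sum\lambda_{\bar C}\cdot f(\bar C)$, where $f(\bar C)\in\bar{\mathfrak C}(T')^*_{prim}$ is the unique class with $f(\bar C)\cap G=\bar C$. For inverse operations use the inverse maps, and for a chain of operations the composition. *)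

theory Defs
  imports "HOL-Algebra.FiniteProduct" "HOL-Algebra.Product_Groups" "HOL-Library.Disjoint_Sets"
begin

section \<open>Based matrices\<close>

text \<open>
  The coefficient group is a commutative group \<open>H\<close> in the sense of HOL-Algebra, hence written
  multiplicatively: \<open>b(g,h) + b(g',h)\<close> becomes \<open>b(g,h) \<otimes> b(g',h)\<close>, and \<open>n b(g,s)\<close> becomes
  \<open>b(g,s) [^] n\<close>.  The form is extensional, so that a record satisfying \<open>based_matrix\<close> is
  determined by the triple \<open>(G, s, b)\<close>.
\<close>

record ('a, 'h) bmatrix =
  elems :: "'a set"
  base :: 'a
  form :: "'a \<times> 'a \<Rightarrow> 'h"

definition based_matrix :: "('h, 'm) monoid_scheme \<Rightarrow> ('a, 'h) bmatrix \<Rightarrow> bool" where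
  "based_matrix H T \<longleftrightarrow>
     finite (elems T) \<and> base T \<in> elems T \<and>
     form T \<in> elems T \<times> elems T \<rightarrow>\<^sub>E carrier H \<and>
     (\<forall>g\<in>elems T. \<forall>h\<in>elems T. form T (h, g) = inv\<^bsub>H\<^esub> form T (g, h)) \<and>
     form T (base T, base T) = \<one>\<^bsub>H\<^esub>"

definition nonbase :: "('a, 'h) bmatrix \<Rightarrow> 'a set" where
  "nonbase T = elems T - {base T}"

definition annihilating :: "('h, 'm) monoid_scheme \<Rightarrow> ('a, 'h) bmatrix \<Rightarrow> 'a \<Rightarrow> bool" where
  "annihilating H T g \<longleftrightarrow> g \<in> nonbase T \<and> (\<forall>h\<in>elems T. form T (g, h) = \<one>\<^bsub>H\<^esub>)"

definition core :: "('a, 'h) bmatrix \<Rightarrow> 'a \<Rightarrow> bool" where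
  "core T g \<longleftrightarrow> g \<in> nonbase T \<and> (\<forall>h\<in>elems T. form T (g, h) = form T (base T, h))"

text \<open>
  An element may be complementary to itself; where a pair of elements is added or deleted, and in
  the definition of primitivity, the two elements are required to be distinct.
\<close>

definition complementary :: "('h, 'm) monoid_scheme \<Rightarrow> ('a, 'h) bmatrix \<Rightarrow> 'a \<Rightarrow> 'a \<Rightarrow> bool" where
  "complementary H T g1 g2 \<longleftrightarrow> g1 \<in> nonbase T \<and> g2 \<in> nonbase T \<and>
     (\<forall>h\<in>elems T. form T (g1, h) \<otimes>\<^bsub>H\<^esub> form T (g2, h) = form T (base T, h))"

definition primitive :: "('h, 'm) monoid_scheme \<Rightarrow> ('a, 'h) bmatrix \<Rightarrow> bool" where
  "primitive H T \<longleftrightarrow> based_matrix H T \<and>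
     (\<nexists>g. annihilating H T g) \<and> (\<nexists>g. core T g) \<and>
     (\<nexists>g1 g2. g1 \<noteq> g2 \<and> complementary H T g1 g2)"

definition automorphisms :: "('a, 'h) bmatrix \<Rightarrow> ('a \<Rightarrow> 'a) set" where
  "automorphisms T = {\<psi>. bij_betw \<psi> (elems T) (elems T) \<and> \<psi> (base T) = base T \<and>
     (\<forall>g\<in>elems T. \<forall>h\<in>elems T. form T (\<psi> g, \<psi> h) = form T (g, h))}"

text \<open>The value \<open>b(g, \<chi>\<^sub>C)\<close> of the biadditive extension of \<open>b\<close>, for \<open>C \<subseteq> G\<close>.\<close>

definition form_char :: "('h, 'm) monoid_scheme \<Rightarrow> ('a, 'h) bmatrix \<Rightarrow> 'a \<Rightarrow> 'a set \<Rightarrow> 'h" where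
  "form_char H T g C = finprod H (\<lambda>h. form T (g, h)) C"


section \<open>Operations and homology\<close>

definition extends_by ::
    "('h, 'm) monoid_scheme \<Rightarrow> ('a, 'h) bmatrix \<Rightarrow> 'a set \<Rightarrow> ('a, 'h) bmatrix \<Rightarrow> bool" where
  "extends_by H T S T' \<longleftrightarrow> based_matrix H T \<and> based_matrix H T' \<and>
     elems T \<inter> S = {} \<and> elems T' = elems T \<union> S \<and> base T' = base T \<and>
     (\<forall>g\<in>elems T. \<forall>h\<in>elems T. form T' (g, h) = form T (g, h))"

definition op_M1 :: "('h, 'm) monoid_scheme \<Rightarrow> ('a, 'h) bmatrix \<Rightarrow> ('a, 'h) bmatrix \<Rightarrow> bool" where
  "op_M1 H T T' \<longleftrightarrow> (\<exists>g. extends_by H T {g} T' \<and> annihilating H T' g)"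

definition op_M2 :: "('h, 'm) monoid_scheme \<Rightarrow> ('a, 'h) bmatrix \<Rightarrow> ('a, 'h) bmatrix \<Rightarrow> bool" where
  "op_M2 H T T' \<longleftrightarrow> (\<exists>g. extends_by H T {g} T' \<and> core T' g)"

definition op_M3 :: "('h, 'm) monoid_scheme \<Rightarrow> ('a, 'h) bmatrix \<Rightarrow> ('a, 'h) bmatrix \<Rightarrow> bool" where
  "op_M3 H T T' \<longleftrightarrow> (\<exists>g g'. g \<noteq> g' \<and> extends_by H T {g, g'} T' \<and> complementary H T' g g')"

definition oper :: "('h, 'm) monoid_scheme \<Rightarrow> ('a, 'h) bmatrix \<Rightarrow> ('a, 'h) bmatrix \<Rightarrow> bool" where
  "oper H T T' \<longleftrightarrow> op_M1 H T T' \<or> op_M2 H T T' \<or> op_M3 H T T'"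

text \<open>
  A chain of operations and inverse operations from \<open>T\<close> to \<open>T'\<close> is the list of the based matrices
  it passes through; \<open>[T]\<close> is the empty chain.  An operation is the inclusion of the smaller
  underlying set, so it is determined by its source and target, and its direction is determined
  by the sizes of the underlying sets.
\<close>

definition chain ::
    "('h, 'm) monoid_scheme \<Rightarrow> ('a, 'h) bmatrix \<Rightarrow> ('a, 'h) bmatrix list \<Rightarrow> ('a, 'h) bmatrix \<Rightarrow> bool"
  where
  "chain H T Ts T' \<longleftrightarrow> Ts \<noteq> [] \<and> hd Ts = T \<and> last Ts = T' \<and> (\<forall>U\<in>set Ts. based_matrix H U) \<and>
     successively (\<lambda>U V. oper H U V \<or> oper H V U) Ts"

definition homologous ::
    "('h, 'm) monoid_scheme \<Rightarrow> ('a, 'h) bmatrix \<Rightarrow> ('a, 'h) bmatrix \<Rightarrow> bool" where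
  "homologous H T T' \<longleftrightarrow> (\<exists>Ts. chain H T Ts T')"

definition homology_class ::
    "('h, 'm) monoid_scheme \<Rightarrow> ('a, 'h) bmatrix \<Rightarrow> ('a, 'h) bmatrix set" where
  "homology_class H T = {T'. homologous H T T'}"


section \<open>Parities and tribal systems on a class \<open>\<T>\<close> of based matrices\<close>

definition parity ::
    "('h, 'm) monoid_scheme \<Rightarrow> ('a, 'h) bmatrix set \<Rightarrow> ('c, 'n) monoid_scheme \<Rightarrow>
     (('a, 'h) bmatrix \<Rightarrow> 'a \<Rightarrow> 'c) \<Rightarrow> bool" where
  "parity H \<T> A p \<longleftrightarrow> comm_group A \<and>
     (\<forall>T\<in>\<T>. p T \<in> elems T \<rightarrow> carrier A \<and> p T (base T) = \<one>\<^bsub>A\<^esub>) \<and>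
     (\<forall>T\<in>\<T>. \<forall>T'\<in>\<T>. oper H T T' \<longrightarrow> (\<forall>g\<in>elems T. p T' g = p T g)) \<and>
     (\<forall>T\<in>\<T>. \<forall>g. annihilating H T g \<or> core T g \<longrightarrow> p T g = \<one>\<^bsub>A\<^esub>) \<and>
     (\<forall>T\<in>\<T>. \<forall>g1 g2. complementary H T g1 g2 \<longrightarrow> p T g1 \<otimes>\<^bsub>A\<^esub> p T g2 = \<one>\<^bsub>A\<^esub>) \<and>
     (\<forall>T\<in>\<T>. \<forall>g1\<in>nonbase T. \<forall>g2\<in>nonbase T. \<forall>g3\<in>nonbase T.
        (\<forall>h\<in>elems T. form T (g1, h) \<otimes>\<^bsub>H\<^esub> form T (g2, h) \<otimes>\<^bsub>H\<^esub> form T (g3, h) = form T (base T, h)) \<longrightarrow>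
        p T g1 \<otimes>\<^bsub>A\<^esub> p T g2 \<otimes>\<^bsub>A\<^esub> p T g3 = \<one>\<^bsub>A\<^esub>)"

definition tribal_system ::
    "('h, 'm) monoid_scheme \<Rightarrow> ('a, 'h) bmatrix set \<Rightarrow> (('a, 'h) bmatrix \<Rightarrow> 'a set set) \<Rightarrow> bool" where
  "tribal_system H \<T> \<CC> \<longleftrightarrow>
     (\<forall>T\<in>\<T>. partition_on (elems T) (\<CC> T) \<and> {base T} \<in> \<CC> T) \<and>
     (\<forall>T\<in>\<T>. \<forall>T'\<in>\<T>. oper H T T' \<longrightarrow>
        (\<forall>C\<in>\<CC> T. \<exists>!C'. C' \<in> \<CC> T' \<and> C = C' \<inter> elems T) \<and>
        \<CC> T = {C' \<inter> elems T |C'. C' \<in> \<CC> T' \<and> C' \<inter> elems T \<noteq> {}}) \<and>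
     (\<forall>T\<in>\<T>. \<forall>g1 g2. complementary H T g1 g2 \<longrightarrow> (\<exists>C\<in>\<CC> T. g1 \<in> C \<and> g2 \<in> C))"


section \<open>Primitive tribes and the zero tribe\<close>

text \<open>\<open>(oper H)\<^sup>*\<^sup>* P T\<close> says that \<open>P\<close> arises from \<open>T\<close> by successive deletions.\<close>

definition primitive_tribe ::
    "('h, 'm) monoid_scheme \<Rightarrow> (('a, 'h) bmatrix \<Rightarrow> 'a set set) \<Rightarrow> ('a, 'h) bmatrix \<Rightarrow> 'a set \<Rightarrow> bool"
  where
  "primitive_tribe H \<CC> T C \<longleftrightarrow> C \<in> \<CC> T \<and>
     (\<exists>P. primitive H P \<and> (oper H)\<^sup>*\<^sup>* P T \<and> C \<inter> elems P \<noteq> {})"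

definition prim_tribes ::
    "('h, 'm) monoid_scheme \<Rightarrow> (('a, 'h) bmatrix \<Rightarrow> 'a set set) \<Rightarrow> ('a, 'h) bmatrix \<Rightarrow> 'a set set" where
  "prim_tribes H \<CC> T = {C. primitive_tribe H \<CC> T C}"

text \<open>Over an infinite type of elements the set below exists and does not depend on the adjoined
  element \<open>g\<close>.\<close>

definition zero_tribe ::
    "('h, 'm) monoid_scheme \<Rightarrow> (('a, 'h) bmatrix \<Rightarrow> 'a set set) \<Rightarrow> ('a, 'h) bmatrix \<Rightarrow> 'a set" where
  "zero_tribe H \<CC> T = (THE D. \<exists>g T' C'. extends_by H T {g} T' \<and> annihilating H T' g \<and>
     C' \<in> \<CC> T' \<and> g \<in> C' \<and> D = C' \<inter> elems T)"


section \<open>The coarsened partition\<close>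

definition invariant_partition ::
    "(('a, 'h) bmatrix \<Rightarrow> 'a set set) \<Rightarrow> ('a, 'h) bmatrix \<Rightarrow> 'a set set \<Rightarrow> bool" where
  "invariant_partition \<CC> T Q \<longleftrightarrow> partition_on (elems T) Q \<and>
     (\<forall>D\<in>Q. (\<exists>\<K>\<subseteq>\<CC> T. D = \<Union>\<K>) \<and> (\<forall>\<psi>\<in>automorphisms T. \<psi> ` D = D))"

definition bar_partition ::
    "(('a, 'h) bmatrix \<Rightarrow> 'a set set) \<Rightarrow> ('a, 'h) bmatrix \<Rightarrow> 'a set set" where
  "bar_partition \<CC> T = (THE Q. invariant_partition \<CC> T Q \<and>
     (\<forall>Q'. invariant_partition \<CC> T Q' \<longrightarrow> refines (elems T) Q Q'))"

definition bar_tribe_partition ::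
    "('h, 'm) monoid_scheme \<Rightarrow> (('a, 'h) bmatrix \<Rightarrow> 'a set set) \<Rightarrow> ('a, 'h) bmatrix \<Rightarrow> 'a set set set"
  where
  "bar_tribe_partition H \<CC> T = {{C \<in> prim_tribes H \<CC> T. C \<subseteq> D} |D. D \<in> bar_partition \<CC> T}"

text \<open>
  The bijection from the primitive tribes of \<open>U\<close> to those of \<open>V\<close>, for \<open>U\<close> and \<open>V\<close> related by an
  operation in either direction.
\<close>

definition tribe_map ::
    "('h, 'm) monoid_scheme \<Rightarrow> (('a, 'h) bmatrix \<Rightarrow> 'a set set) \<Rightarrow>
     ('a, 'h) bmatrix \<Rightarrow> ('a, 'h) bmatrix \<Rightarrow> 'a set \<Rightarrow> 'a set" where
  "tribe_map H \<CC> U V = (if oper H V U then (\<lambda>C. C \<inter> elems V)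
     else inv_into (prim_tribes H \<CC> V) (\<lambda>C. C \<inter> elems U))"

text \<open>
  Carry a partition \<open>\<Q>\<close> of the set of primitive tribes of the last matrix of a chain back to the
  first one.
\<close>

fun transport ::
    "('h, 'm) monoid_scheme \<Rightarrow> (('a, 'h) bmatrix \<Rightarrow> 'a set set) \<Rightarrow>
     ('a, 'h) bmatrix list \<Rightarrow> 'a set set set \<Rightarrow> 'a set set set" where
  "transport H \<CC> [] \<Q> = \<Q>"
| "transport H \<CC> [T] \<Q> = \<Q>"
| "transport H \<CC> (T # U # Ts) \<Q> = (\<lambda>\<K>. tribe_map H \<CC> U T ` \<K>) ` transport H \<CC> (U # Ts) \<Q>"

text \<open>
  In what follows \<open>P\<close> is the chosen primitive matrix.  The transported partition does not depend
  on the chain \<open>Ts\<close>.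
\<close>

definition bar_prim ::
    "('h, 'm) monoid_scheme \<Rightarrow> (('a, 'h) bmatrix \<Rightarrow> 'a set set) \<Rightarrow>
     ('a, 'h) bmatrix \<Rightarrow> ('a, 'h) bmatrix \<Rightarrow> 'a set set" where
  "bar_prim H \<CC> P T =
     Union ` (THE \<Q>. \<exists>Ts. chain H T Ts P \<and> \<Q> = transport H \<CC> Ts (bar_tribe_partition H \<CC> P))"

definition zero_class ::
    "('h, 'm) monoid_scheme \<Rightarrow> (('a, 'h) bmatrix \<Rightarrow> 'a set set) \<Rightarrow>
     ('a, 'h) bmatrix \<Rightarrow> ('a, 'h) bmatrix \<Rightarrow> 'a set" where
  "zero_class H \<CC> P T = (if primitive_tribe H \<CC> T (zero_tribe H \<CC> T)
     then (THE D. D \<in> bar_prim H \<CC> P T \<and> zero_tribe H \<CC> T \<subseteq> D) else {})"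

definition bar_star ::
    "('h, 'm) monoid_scheme \<Rightarrow> (('a, 'h) bmatrix \<Rightarrow> 'a set set) \<Rightarrow>
     ('a, 'h) bmatrix \<Rightarrow> ('a, 'h) bmatrix \<Rightarrow> 'a set set" where
  "bar_star H \<CC> P T = bar_prim H \<CC> P T - {zero_class H \<CC> P T}"


section \<open>The groups and maps\<close>

text \<open>
  \<open>H[S]\<close> is the direct sum of copies of \<open>H\<close> indexed by \<open>S\<close>; the formal sum with coefficients
  \<open>\<lambda>\<^sub>x\<close> is the function \<open>x \<mapsto> \<lambda>\<^sub>x\<close> on \<open>S\<close>.
\<close>

definition formal_sums :: "('h, 'm) monoid_scheme \<Rightarrow> 'x set \<Rightarrow> ('x \<Rightarrow> 'h) monoid" where
  "formal_sums H S = sum_group S (\<lambda>_. H)"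

definition bar_s ::
    "('h, 'm) monoid_scheme \<Rightarrow> (('a, 'h) bmatrix \<Rightarrow> 'a set set) \<Rightarrow>
     ('a, 'h) bmatrix \<Rightarrow> ('a, 'h) bmatrix \<Rightarrow> 'a set \<Rightarrow> 'h" where
  "bar_s H \<CC> P T = (\<lambda>D\<in>bar_star H \<CC> P T. form_char H T (base T) D)"

definition bar_s_subgroup ::
    "('h, 'm) monoid_scheme \<Rightarrow> (('a, 'h) bmatrix \<Rightarrow> 'a set set) \<Rightarrow>
     ('a, 'h) bmatrix \<Rightarrow> ('a, 'h) bmatrix \<Rightarrow> ('a set \<Rightarrow> 'h) set" where
  "bar_s_subgroup H \<CC> P T = generate (formal_sums H (bar_star H \<CC> P T)) {bar_s H \<CC> P T}"

definition bar_A ::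
    "('h, 'm) monoid_scheme \<Rightarrow> (('a, 'h) bmatrix \<Rightarrow> 'a set set) \<Rightarrow>
     ('a, 'h) bmatrix \<Rightarrow> ('a, 'h) bmatrix \<Rightarrow> ('a set \<Rightarrow> 'h) set monoid" where
  "bar_A H \<CC> P T = formal_sums H (bar_star H \<CC> P T) Mod bar_s_subgroup H \<CC> P T"

definition bar_proj ::
    "('h, 'm) monoid_scheme \<Rightarrow> (('a, 'h) bmatrix \<Rightarrow> 'a set set) \<Rightarrow>
     ('a, 'h) bmatrix \<Rightarrow> ('a, 'h) bmatrix \<Rightarrow> ('a set \<Rightarrow> 'h) \<Rightarrow> ('a set \<Rightarrow> 'h) set" where
  "bar_proj H \<CC> P T x = bar_s_subgroup H \<CC> P T #>\<^bsub>formal_sums H (bar_star H \<CC> P T)\<^esub> x"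

definition bar_P ::
    "('h, 'm) monoid_scheme \<Rightarrow> (('a, 'h) bmatrix \<Rightarrow> 'a set set) \<Rightarrow>
     ('a, 'h) bmatrix \<Rightarrow> ('a, 'h) bmatrix \<Rightarrow> 'a \<Rightarrow> ('a set \<Rightarrow> 'h) set" where
  "bar_P H \<CC> P T g = bar_proj H \<CC> P T (\<lambda>D\<in>bar_star H \<CC> P T.
     form_char H T g D \<otimes>\<^bsub>H\<^esub> inv\<^bsub>H\<^esub> (form T (g, base T) [^]\<^bsub>H\<^esub> (card D div 2)))"

definition class_map ::
    "('h, 'm) monoid_scheme \<Rightarrow> (('a, 'h) bmatrix \<Rightarrow> 'a set set) \<Rightarrow>
     ('a, 'h) bmatrix \<Rightarrow> ('a, 'h) bmatrix \<Rightarrow> ('a, 'h) bmatrix \<Rightarrow> 'a set \<Rightarrow> 'a set" where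
  "class_map H \<CC> P T T' D = (THE D'. D' \<in> bar_star H \<CC> P T' \<and> D' \<inter> elems T = D)"

text \<open>
  For \<open>f : S \<rightarrow> S'\<close>, the homomorphism \<open>H[S] \<rightarrow> H[S']\<close> sending the formal sum of the
  \<open>\<lambda>\<^sub>x \<cdot> x\<close> to that of the \<open>\<lambda>\<^sub>x \<cdot> f x\<close>: the coefficient of \<open>y\<close> is the sum of the \<open>\<lambda>\<^sub>x\<close> with \<open>f x = y\<close>.
\<close>

definition push ::
    "('h, 'm) monoid_scheme \<Rightarrow> 'x set \<Rightarrow> 'y set \<Rightarrow> ('x \<Rightarrow> 'y) \<Rightarrow> ('x \<Rightarrow> 'h) \<Rightarrow> 'y \<Rightarrow> 'h" where
  "push H S S' f l = (\<lambda>y\<in>S'. finprod H l {x \<in> S. f x = y})"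

text \<open>The map on quotients for an operation from \<open>T\<close> to \<open>T'\<close>; the image of the coset \<open>K\<close> under
  the composite of \<open>push\<close> and the projection is a singleton.\<close>

definition bar_A_oper ::
    "('h, 'm) monoid_scheme \<Rightarrow> (('a, 'h) bmatrix \<Rightarrow> 'a set set) \<Rightarrow>
     ('a, 'h) bmatrix \<Rightarrow> ('a, 'h) bmatrix \<Rightarrow> ('a, 'h) bmatrix \<Rightarrow>
     ('a set \<Rightarrow> 'h) set \<Rightarrow> ('a set \<Rightarrow> 'h) set" where
  "bar_A_oper H \<CC> P T T' K = the_elem
     ((\<lambda>x. bar_proj H \<CC> P T'
            (push H (bar_star H \<CC> P T) (bar_star H \<CC> P T') (class_map H \<CC> P T T') x)) ` K)"

definition bar_A_step ::
    "('h, 'm) monoid_scheme \<Rightarrow> (('a, 'h) bmatrix \<Rightarrow> 'a set set) \<Rightarrow>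
     ('a, 'h) bmatrix \<Rightarrow> ('a, 'h) bmatrix \<Rightarrow> ('a, 'h) bmatrix \<Rightarrow>
     ('a set \<Rightarrow> 'h) set \<Rightarrow> ('a set \<Rightarrow> 'h) set" where
  "bar_A_step H \<CC> P U V = (if oper H U V then bar_A_oper H \<CC> P U V
     else inv_into (carrier (bar_A H \<CC> P V)) (bar_A_oper H \<CC> P V U))"

fun bar_A_chain ::
    "('h, 'm) monoid_scheme \<Rightarrow> (('a, 'h) bmatrix \<Rightarrow> 'a set set) \<Rightarrow>
     ('a, 'h) bmatrix \<Rightarrow> ('a, 'h) bmatrix list \<Rightarrow>
     ('a set \<Rightarrow> 'h) set \<Rightarrow> ('a set \<Rightarrow> 'h) set" where
  "bar_A_chain H \<CC> P [] = id"
| "bar_A_chain H \<CC> P [T] = id"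
| "bar_A_chain H \<CC> P (T # U # Ts) = bar_A_chain H \<CC> P (U # Ts) \<circ> bar_A_step H \<CC> P T U"

end

theory Submission
  imports Defs
begin

text \<open>
  A class \<open>C\<close> of the coarsened partition other than the zero class contains no annihilating or core
  element, and it contains both or none of two complementary elements.  So the coefficient
  \<open>b(g, \<chi>\<^sub>C) - \<lfloor>|C| / 2\<rfloor> b(g, s)\<close> does not change under an operation: a new complementary pair in
  \<open>C\<close> contributes \<open>b(g, s)\<close> to the first term and raises \<open>\<lfloor>|C| / 2\<rfloor>\<close> by one.  The coefficient is
  additive in the row \<open>b(g, -)\<close>, and the row of \<open>s\<close> gives the relation that is divided out; hence
  (P1), (P2) and (P3).

  Deletions are confluent up to exchanging two elements of the same tribe, so two primitive reducts
  of \<open>T\<close> are isomorphic by a map that respects the tribes of \<open>T\<close>.  Hence two embeddings of \<open>P\<close> into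
  \<open>T\<close> as a primitive reduct differ, up to tribes, by an automorphism of \<open>P\<close>.  As the classes of \<open>P\<close> are
  invariant under automorphisms, they index the classes of every \<open>T\<close> independently of any chain, and
  all the groups are identified with one quotient of the group of formal sums over the classes of
  \<open>P\<close>, compatibly with the operations.
\<close>

section \<open>Deletions and isomorphisms of based matrices\<close>

text \<open>Deletions fail to commute in only one situation: two pairs {g, a} and {g, b} share g.
  Then the rows of a and b both equal b(s, -) - b(g, -), so exchanging a and b is an automorphism of
  the matrix, and condition (iii) puts a and b into the tribe of g. This is why the comparison of
  primitive reducts can be made to respect tribes.

  A chain goes up as well as down, and a primitive reduct of the larger matrix need not lie in the
  smaller one. Individual elements of \<open>P\<close> therefore cannot be followed along a chain,
  but their tribes can; the objects that are propagated are embeddings of \<open>P\<close> known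
  only up to tribes (\<open>marking\<close>).

  In the coefficient only the increments of the floor matter: an operation changes |C| by 0 or 2, so
  the floor changes by 0 or 1 even when |C| is odd. The zero tribe becomes visible only after the
  matrix is enlarged, so every statement about it adjoins fresh elements, which the infinite type
  provides.\<close>

definition submatrix :: "('a, 'h) bmatrix \<Rightarrow> 'a set \<Rightarrow> ('a, 'h) bmatrix" where
  "submatrix T X = \<lparr>elems = X, base = base T, form = restrict (form T) (X \<times> X)\<rparr>"

definition deletable :: "('h, 'm) monoid_scheme \<Rightarrow> ('a, 'h) bmatrix \<Rightarrow> 'a set \<Rightarrow> bool" where
  "deletable H T S \<longleftrightarrow> (\<exists>g. S = {g} \<and> (annihilating H T g \<or> core T g)) \<or>
     (\<exists>g g'. g \<noteq> g' \<and> S = {g, g'} \<and> complementary H T g g')"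

definition isomorphism :: "('a \<Rightarrow> 'a) \<Rightarrow> ('a, 'h) bmatrix \<Rightarrow> ('a, 'h) bmatrix \<Rightarrow> bool" where
  "isomorphism \<phi> T T' \<longleftrightarrow> bij_betw \<phi> (elems T) (elems T') \<and> \<phi> (base T) = base T' \<and>
     (\<forall>g\<in>elems T. \<forall>h\<in>elems T. form T' (\<phi> g, \<phi> h) = form T (g, h))"

lemma based_matrixD:
  assumes "based_matrix H T"
  shows "finite (elems T)" "base T \<in> elems T" "form T \<in> elems T \<times> elems T \<rightarrow>\<^sub>E carrier H"
    "form T (base T, base T) = \<one>\<^bsub>H\<^esub>"
  using assms by (simp_all only: based_matrix_def)

lemma based_matrix_skew:
  assumes "based_matrix H T" "g \<in> elems T" "h \<in> elems T"
  shows "form T (h, g) = inv\<^bsub>H\<^esub> form T (g, h)"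
  using assms(1)[unfolded based_matrix_def] assms(2,3) by (elim conjE) (drule (1) bspec, drule (1) bspec, assumption)

lemma elems_submatrix [simp]: "elems (submatrix T X) = X"
  and base_submatrix [simp]: "base (submatrix T X) = base T"
  by (auto simp: submatrix_def)

lemma form_submatrix [simp]: "x \<in> X \<Longrightarrow> y \<in> X \<Longrightarrow> form (submatrix T X) (x, y) = form T (x, y)"
  by (simp add: submatrix_def)

lemma submatrix_submatrix: "Y \<subseteq> X \<Longrightarrow> submatrix (submatrix T X) Y = submatrix T Y"
  by (auto simp: submatrix_def fun_eq_iff restrict_def)

lemma automorphisms_eq: "automorphisms T = {\<phi>. isomorphism \<phi> T T}"
  by (simp add: automorphisms_def isomorphism_def)

lemma isomorphism_id: "isomorphism id T T"
  by (simp add: isomorphism_def)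

lemma isomorphismD:
  assumes "isomorphism \<phi> T T'"
  shows "inj_on \<phi> (elems T)" "\<phi> ` elems T = elems T'" "\<phi> (base T) = base T'"
    "\<And>g h. g \<in> elems T \<Longrightarrow> h \<in> elems T \<Longrightarrow> form T' (\<phi> g, \<phi> h) = form T (g, h)"
  using assms by (simp_all add: isomorphism_def bij_betw_def)

lemma isomorphism_comp:
  assumes "isomorphism \<phi> T T'" "isomorphism \<psi> T' T''"
  shows "isomorphism (\<psi> \<circ> \<phi>) T T''"
proof -
  have "\<phi> g \<in> elems T'" if "g \<in> elems T" for g
    using isomorphismD(2)[OF assms(1)] that by blast
  then show ?thesis
    using assms unfolding isomorphism_def by (auto intro: bij_betw_trans)
qed

lemma isomorphism_inv:
  assumes iso: "isomorphism \<phi> T T'" and s: "base T \<in> elems T"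
  shows "isomorphism (inv_into (elems T) \<phi>) T' T"
proof -
  let ?i = "inv_into (elems T) \<phi>"
  have b: "bij_betw \<phi> (elems T) (elems T')"
    using iso by (simp add: isomorphism_def)
  have i: "?i g \<in> elems T" "\<phi> (?i g) = g" if "g \<in> elems T'" for g
    using that b by (simp_all add: bij_betw_inv_into_right bij_betw_imp_surj_on inv_into_into)
  have "form T (?i g, ?i h) = form T' (g, h)" if "g \<in> elems T'" "h \<in> elems T'" for g h
    using isomorphismD(4)[OF iso i(1)[OF that(1)] i(1)[OF that(2)]] i(2) that by simp
  moreover have "?i (base T') = base T"
    using bij_betw_inv_into_left[OF b s] isomorphismD(3)[OF iso] by simp
  ultimately show ?thesis
    using b by (simp add: isomorphism_def bij_betw_inv_into)
qed

lemma isomorphism_nonbase: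
  assumes "isomorphism \<phi> T T'" "base T \<in> elems T" "g \<in> nonbase T"
  shows "\<phi> g \<in> nonbase T'"
  using assms(2,3) isomorphismD(2,3)[OF assms(1)] inj_on_eq_iff[OF isomorphismD(1)[OF assms(1)]]
  unfolding nonbase_def by (metis Diff_iff imageI singletonD singletonI)

lemma isomorphism_deletable:
  assumes iso: "isomorphism \<phi> T T'" and s: "base T \<in> elems T" and S: "deletable H T S"
  shows "deletable H T' (\<phi> ` S)"
proof -
  have im: "elems T' = \<phi> ` elems T" and inj: "inj_on \<phi> (elems T)" and bs: "\<phi> (base T) = base T'"
    and f: "\<And>g h. g \<in> elems T \<Longrightarrow> h \<in> elems T \<Longrightarrow> form T' (\<phi> g, \<phi> h) = form T (g, h)"
    using isomorphismD[OF iso] by simp_all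
  have nb: "g \<in> nonbase T \<Longrightarrow> g \<in> elems T \<and> \<phi> g \<in> nonbase T'" for g
    using isomorphism_nonbase[OF iso s] by (auto simp: nonbase_def)
  have fs: "h \<in> elems T \<Longrightarrow> form T' (base T', \<phi> h) = form T (base T, h)" for h
    using f[OF s] bs by simp
  consider g where "S = {g}" "annihilating H T g" | g where "S = {g}" "core T g"
    | g g' where "g \<noteq> g'" "S = {g, g'}" "complementary H T g g'"
    using S by (auto simp: deletable_def)
  then show ?thesis
  proof cases
    case 1
    then have "annihilating H T' (\<phi> g)"
      using nb by (auto simp: annihilating_def im f)
    with 1 show ?thesis by (auto simp: deletable_def)
  next
    case 2
    then have "core T' (\<phi> g)"
      using nb by (auto simp: core_def im f fs)
    with 2 show ?thesis by (auto simp: deletable_def)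
  next
    case 3
    then have "complementary H T' (\<phi> g) (\<phi> g')"
      using nb by (auto simp: complementary_def im f fs)
    moreover have "\<phi> g \<noteq> \<phi> g'"
      using 3 inj nb by (auto simp: complementary_def dest: inj_onD)
    ultimately show ?thesis using 3 by (auto simp: deletable_def)
  qed
qed

lemma isomorphism_submatrix:
  assumes iso: "isomorphism \<phi> T T" and X: "X \<subseteq> elems T"
  shows "isomorphism \<phi> (submatrix T X) (submatrix T (\<phi> ` X))"
proof -
  have "bij_betw \<phi> X (\<phi> ` X)"
    using isomorphismD(1)[OF iso] X by (simp add: bij_betw_def inj_on_subset)
  moreover have "form T (\<phi> g, \<phi> h) = form T (g, h)" if "g \<in> X" "h \<in> X" for g h
    using isomorphismD(4)[OF iso, of g h] X that by blast
  ultimately show ?thesis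
    using isomorphismD(3)[OF iso] unfolding isomorphism_def by simp
qed

lemma deletable_nonbase: "deletable H T S \<Longrightarrow> S \<subseteq> nonbase T \<and> S \<noteq> {}"
  by (auto simp: deletable_def annihilating_def core_def complementary_def)

text \<open>Each kind of deletability is an equation demanded of every column, so it survives the
  loss of columns. The base is kept because two of the equations refer to its row.\<close>

lemma deletable_submatrix:
  assumes "deletable H T S" "S \<subseteq> X" "base T \<in> X" "X \<subseteq> elems T"
  shows "deletable H (submatrix T X) S"
proof -
  consider g where "S = {g}" "annihilating H T g" | g where "S = {g}" "core T g"
    | g g' where "g \<noteq> g'" "S = {g, g'}" "complementary H T g g'"
    using assms by (auto simp: deletable_def)
  then show ?thesis
  proof cases
    case 1
    then have "annihilating H (submatrix T X) g"
      using assms by (auto simp: annihilating_def nonbase_def)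
    with 1 show ?thesis by (auto simp: deletable_def)
  next
    case 2
    then have "core (submatrix T X) g"
      using assms by (auto simp: core_def nonbase_def)
    with 2 show ?thesis by (auto simp: deletable_def)
  next
    case 3
    then have "complementary H (submatrix T X) g g'"
      using assms by (auto simp: complementary_def nonbase_def)
    with 3 show ?thesis by (auto simp: deletable_def)
  qed
qed

lemma based_submatrix:
  assumes T: "based_matrix H T" and X: "X \<subseteq> elems T" "base T \<in> X"
  shows "based_matrix H (submatrix T X)"
  unfolding based_matrix_def
proof (intro conjI ballI)
  show "form (submatrix T X) \<in> elems (submatrix T X) \<times> elems (submatrix T X) \<rightarrow>\<^sub>E carrier H"
    using based_matrixD(3)[OF T] X by (auto simp: submatrix_def)
  show "form (submatrix T X) (h, g) = inv\<^bsub>H\<^esub> form (submatrix T X) (g, h)"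
    if "g \<in> elems (submatrix T X)" "h \<in> elems (submatrix T X)" for g h
    using based_matrix_skew[OF T, of g h] that X by auto
qed (use based_matrixD(1,2,4)[OF T] X in \<open>auto simp: finite_subset\<close>)

section \<open>Operations read backwards as deletions; reducts\<close>

lemma primitive_iff_no_deletable:
  "primitive H T \<longleftrightarrow> based_matrix H T \<and> (\<nexists>S. deletable H T S)"
  unfolding primitive_def deletable_def by blast

text \<open>Forms are extensional, so the smaller matrix of an operation is literally a restriction
  of the larger one, as a record. An operation thus becomes the choice of a deletable set in its
  target, and confluence can be argued with subsets of one matrix.\<close>

lemma oper_iff_deletable:
  fixes T :: "('a, 'h) bmatrix"
  shows "oper H U T \<longleftrightarrow>
    based_matrix H T \<and> (\<exists>S. deletable H T S \<and> U = submatrix T (elems T - S))"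
proof
  assume "oper H U T"
  then obtain S where S: "extends_by H U S T" "deletable H T S"
    unfolding oper_def op_M1_def op_M2_def op_M3_def deletable_def by blast
  have e: "elems U = elems T - S" "base U = base T" "based_matrix H T"
    and f: "\<And>g h. g \<in> elems U \<Longrightarrow> h \<in> elems U \<Longrightarrow> form U (g, h) = form T (g, h)"
    and x: "form U \<in> elems U \<times> elems U \<rightarrow>\<^sub>E carrier H"
    using S(1) based_matrixD(3)[of H U] by (auto simp: extends_by_def)
  have "form U = restrict (form T) (elems U \<times> elems U)"
  proof
    fix p show "form U p = restrict (form T) (elems U \<times> elems U) p"
    proof (cases "p \<in> elems U \<times> elems U")
      case True
      then obtain g h where "p = (g, h)" "g \<in> elems U" "h \<in> elems U" by blast
      then show ?thesis using f[of g h] by simp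
    next
      case False
      then show ?thesis using PiE_arb[OF x] by simp
    qed
  qed
  then have "U = submatrix T (elems T - S)"
    by (intro bmatrix.equality) (simp_all add: submatrix_def e)
  with S e show "based_matrix H T \<and> (\<exists>S. deletable H T S \<and> U = submatrix T (elems T - S))"
    by blast
next
  assume "based_matrix H T \<and> (\<exists>S. deletable H T S \<and> U = submatrix T (elems T - S))"
  then obtain S where T: "based_matrix H T" and S: "deletable H T S"
    and U: "U = submatrix T (elems T - S)"
    by blast
  have sub: "S \<subseteq> nonbase T" using deletable_nonbase[OF S] by simp
  have "based_matrix H U"
    unfolding U using sub based_matrixD(2)[OF T] by (intro based_submatrix[OF T]) (auto simp: nonbase_def)
  then have "extends_by H U S T"
    using T sub based_matrixD(2)[OF T] by (auto simp: extends_by_def U nonbase_def)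
  with S show "oper H U T"
    unfolding oper_def op_M1_def op_M2_def op_M3_def deletable_def by blast
qed

lemma oper_based:
  assumes "oper H U T"
  shows "based_matrix H U" "based_matrix H T"
  using assms unfolding oper_def op_M1_def op_M2_def op_M3_def extends_by_def by blast+

lemma oper_psubset:
  assumes "oper H U T"
  shows "elems U \<subset> elems T" "base U = base T" "card (elems U) < card (elems T)"
proof -
  obtain S where S: "deletable H T S" "U = submatrix T (elems T - S)" "based_matrix H T"
    using assms by (auto simp: oper_iff_deletable)
  then show "elems U \<subset> elems T" "base U = base T"
    using deletable_nonbase[OF S(1)] by (auto simp: nonbase_def)
  then show "card (elems U) < card (elems T)"
    using based_matrixD(1)[OF S(3)] by (simp add: psubset_card_mono)
qed

lemma oper_form:
  assumes "oper H U T" "x \<in> elems U" "y \<in> elems U"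
  shows "form U (x, y) = form T (x, y)"
  using assms by (auto simp: oper_iff_deletable)

text \<open>A reduct is recovered from \<open>T\<close> and its underlying set alone, so
  automorphisms of \<open>T\<close> can move reducts as plain subsets.\<close>

lemma reduct_based:
  assumes "(oper H)\<^sup>*\<^sup>* U T" "based_matrix H T"
  shows "based_matrix H U \<and> elems U \<subseteq> elems T \<and> base U = base T \<and> U = submatrix T (elems U)"
  using assms
proof (induction rule: converse_rtranclp_induct)
  case base
  have "restrict (form T) (elems T \<times> elems T) = form T"
    using based_matrixD(3)[OF base] by (auto simp: PiE_def extensional_restrict)
  then show ?case
    by (intro conjI base bmatrix.equality) (simp_all add: submatrix_def)
next
  case (step U V)
  then have V: "elems V \<subseteq> elems T" "base V = base T" "V = submatrix T (elems V)"
    by auto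
  obtain S where S: "deletable H V S" "U = submatrix V (elems V - S)"
    using step by (auto simp: oper_iff_deletable)
  then have "U = submatrix T (elems U)"
    using V by (metis Diff_subset elems_submatrix submatrix_submatrix)
  then show ?case
    using V oper_based(1)[OF step(1)] oper_psubset[OF step(1)] by auto
qed

lemma exists_primitive_reduct:
  assumes "based_matrix H T"
  shows "\<exists>R. primitive H R \<and> (oper H)\<^sup>*\<^sup>* R T"
  using assms
proof (induction "card (elems T)" arbitrary: T rule: less_induct)
  case less
  show ?case
  proof (cases "primitive H T")
    case False
    then obtain S where S: "deletable H T S"
      using less by (auto simp: primitive_iff_no_deletable)
    define U where "U = submatrix T (elems T - S)"
    have "oper H U T"
      using S less by (auto simp: oper_iff_deletable U_def)
    with less(1)[of U] show ?thesis
      by (meson oper_based(1) oper_psubset(3) rtranclp.rtrancl_into_rtrancl)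
  qed auto
qed

lemma primitive_reduct_eq:
  assumes "primitive H T" "(oper H)\<^sup>*\<^sup>* R T"
  shows "R = T"
  using assms(2) assms(1)
  by cases (auto simp: oper_iff_deletable primitive_iff_no_deletable)

text \<open>An automorphism of \<open>T\<close> carries a sequence of deletions inside
  \<open>T\<close> to another one. In the exceptional case of confluence this turns a reduct of one
  deletion of \<open>T\<close> into a reduct of the other.\<close>

lemma automorphism_reduct:
  assumes T: "based_matrix H T" and iso: "isomorphism \<phi> T T"
    and V: "V = submatrix T Y" "Y \<subseteq> elems T" "base T \<in> Y"
    and Q: "(oper H)\<^sup>*\<^sup>* Q V"
  shows "(oper H)\<^sup>*\<^sup>* (submatrix T (\<phi> ` elems Q)) (submatrix T (\<phi> ` Y))"
  using Q
proof (induction rule: converse_rtranclp_induct)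
  case base
  then show ?case using V by simp
next
  case (step Q W)
  have "based_matrix H V" using V T based_submatrix by blast
  with reduct_based[OF step(2)] V
  have W: "elems W \<subseteq> Y" "base W = base T" "W = submatrix T (elems W)" and Wb: "based_matrix H W"
    by (auto simp: submatrix_submatrix)
  note W = W based_matrixD(2)[OF Wb]
  obtain S where S: "deletable H W S" "Q = submatrix W (elems W - S)"
    using step by (auto simp: oper_iff_deletable)
  have inj: "inj_on \<phi> (elems T)" and im: "\<phi> ` elems T = elems T" and bs: "\<phi> (base T) = base T"
    using isomorphismD[OF iso] by simp_all
  have WT: "elems W \<subseteq> elems T" using W V by auto
  have SW: "S \<subseteq> elems W" using deletable_nonbase[OF S(1)] by (auto simp: nonbase_def)
  let ?W = "submatrix T (\<phi> ` elems W)"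
  have "isomorphism \<phi> W ?W"
    using isomorphism_submatrix[OF iso WT] W(3) by simp
  from isomorphism_deletable[OF this W(4) S(1)]
  have "deletable H ?W (\<phi> ` S)" .
  moreover have "based_matrix H ?W"
    using T W(2,4) WT im bs by (intro based_submatrix) (auto simp: image_iff, metis)
  moreover have "submatrix T (\<phi> ` elems Q) = submatrix ?W (elems ?W - \<phi> ` S)"
  proof -
    have "\<phi> ` (elems W - S) = \<phi> ` elems W - \<phi> ` S"
      using inj WT SW by (metis inj_on_image_set_diff inj_on_subset Diff_subset)
    then show ?thesis
      using S by (simp add: submatrix_submatrix)
  qed
  ultimately have "oper H (submatrix T (\<phi> ` elems Q)) ?W"
    by (auto simp: oper_iff_deletable)
  then show ?case using step.IH by (rule converse_rtranclp_into_rtranclp)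
qed

lemma isomorphism_primitive:
  assumes "isomorphism \<phi> T T'" "based_matrix H T'" "primitive H T"
  shows "primitive H T'"
proof -
  have s: "base T \<in> elems T" "base T' \<in> elems T'"
    using assms based_matrixD(2) by (auto simp: primitive_def)
  then show ?thesis
    using assms isomorphism_deletable[OF isomorphism_inv[OF assms(1) s(1)] s(2)]
    by (auto simp: primitive_iff_no_deletable)
qed

locale based_matrices = comm_group H for H :: "('h, 'm) monoid_scheme" (structure)
begin

lemma form_closed:
  "based_matrix H T \<Longrightarrow> x \<in> elems T \<Longrightarrow> y \<in> elems T \<Longrightarrow> form T (x, y) \<in> carrier H"
  using based_matrixD(3) by blast

text \<open>Skew-symmetry turns equal rows into equal columns, so the exchange can be undone in each
  argument of the form separately.\<close>

lemma swap_automorphism: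
  assumes T: "based_matrix H T" and a: "a \<in> nonbase T" and b: "b \<in> nonbase T"
    and row: "\<And>h. h \<in> elems T \<Longrightarrow> form T (a, h) = form T (b, h)"
  shows "isomorphism (id(a := b, b := a)) T T"
proof -
  let ?w = "id(a := b, b := a)"
  have ab: "a \<in> elems T" "b \<in> elems T" "base T \<noteq> a" "base T \<noteq> b"
    using a b by (auto simp: nonbase_def)
  have col: "form T (h, a) = form T (h, b)" if "h \<in> elems T" for h
    using based_matrix_skew[OF T ab(1) that] based_matrix_skew[OF T ab(2) that] row[OF that] by simp
  have w: "?w g \<in> elems T" if "g \<in> elems T" for g
    using ab that by simp
  have "form T (?w g, ?w h) = form T (g, h)" if "g \<in> elems T" "h \<in> elems T" for g h
  proof -
    have "form T (?w g, ?w h) = form T (g, ?w h)"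
      using row[OF w[OF that(2)]] by (cases "g = b"; cases "g = a") (simp_all del: fun_upd_apply add: fun_upd_apply[of _ _ _ g] fun_upd_apply[of _ _ _ a] fun_upd_apply[of _ _ _ b])
    also have "\<dots> = form T (g, h)"
      using col[OF that(1)] by simp
    finally show ?thesis .
  qed
  moreover have "bij_betw ?w (elems T) (elems T)"
    by (rule bij_betw_byWitness[of _ ?w]) (use ab in auto)
  ultimately show ?thesis
    unfolding isomorphism_def using ab by simp
qed

end

section \<open>Local confluence of deletions\<close>

context based_matrices
begin

lemma complementary_sym:
  assumes "based_matrix H T" "complementary H T g g'"
  shows "complementary H T g' g"
  using assms form_closed[OF assms(1)] unfolding complementary_def nonbase_def
  by (metis Diff_iff m_comm)

text \<open>The two rows add up to that of the base, so a zero row leaves the row of the base for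
  the partner, and conversely. Consequently, if one member of a pair can be deleted alone, so can
  the other.\<close>

lemma complementary_annihilating_core:
  assumes T: "based_matrix H T" and c: "complementary H T g a"
  shows "annihilating H T g \<Longrightarrow> core T a" "core T g \<Longrightarrow> annihilating H T a"
proof -
  have a: "a \<in> nonbase T" "a \<in> elems T" "base T \<in> elems T"
    using c based_matrixD(2)[OF T] by (auto simp: complementary_def nonbase_def)
  have e: "form T (g, h) \<otimes> form T (a, h) = form T (base T, h)" if "h \<in> elems T" for h
    using c that by (simp add: complementary_def)
  show "core T a" if "annihilating H T g"
    unfolding core_def
  proof (intro conjI ballI a)
    fix h assume h: "h \<in> elems T"
    show "form T (a, h) = form T (base T, h)"
      using e[OF h] that h form_closed[OF T a(2) h] by (simp add: annihilating_def)
  qed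
  show "annihilating H T a" if "core T g"
    unfolding annihilating_def
  proof (intro conjI ballI a)
    fix h assume h: "h \<in> elems T"
    have "form T (base T, h) \<otimes> form T (a, h) = form T (base T, h)"
      using e[OF h] that h by (simp add: core_def)
    then show "form T (a, h) = \<one>"
      using form_closed[OF T a(2) h] form_closed[OF T a(3) h] by simp
  qed
qed

lemma annihilating_core_complementary:
  assumes "based_matrix H T" "annihilating H T g" "core T k"
  shows "complementary H T g k"
  using assms form_closed[OF assms(1) based_matrixD(2)[OF assms(1)]]
  by (simp add: annihilating_def core_def complementary_def)

lemma delete_two:
  assumes T: "based_matrix H T" and S: "deletable H T S" and R: "deletable H T R" and d: "R \<inter> S = {}"
  shows "oper H (submatrix T (elems T - (S \<union> R))) (submatrix T (elems T - S))"
proof -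
  have n: "S \<subseteq> nonbase T" "R \<subseteq> nonbase T"
    using deletable_nonbase S R by blast+
  have s: "base T \<in> elems T - S"
    using n based_matrixD(2)[OF T] by (auto simp: nonbase_def)
  have "deletable H (submatrix T (elems T - S)) R"
    using n d s by (intro deletable_submatrix[OF R]) (auto simp: nonbase_def)
  moreover have "submatrix T (elems T - (S \<union> R)) =
      submatrix (submatrix T (elems T - S)) (elems (submatrix T (elems T - S)) - R)"
    by (simp add: submatrix_submatrix) (simp add: Diff_eq Int_assoc)
  ultimately show ?thesis
    using based_submatrix[OF T Diff_subset s] by (auto simp: oper_iff_deletable)
qed

lemma pair_containing:
  assumes "based_matrix H T" "S = {g1, g2}" "g1 \<noteq> g2" "complementary H T g1 g2" "g \<in> S"
  obtains a where "S = {g, a}" "g \<noteq> a" "complementary H T g a"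
  using assms complementary_sym[OF assms(1,4)] by (metis insertE insert_commute singletonD)

text \<open>Disjoint deletions commute, and a single element inside a pair is absorbed by deleting
  its partner next. What remains is two pairs with exactly one common element \<open>g\<close>:
  after either deletion the surviving one of \<open>a\<close> and \<open>b\<close> has lost its
  partner and need not be deletable. This is kept as a separate outcome and repaired later by an
  exchange of \<open>a\<close> and \<open>b\<close>.\<close>

lemma deletions_confluent:
  assumes T: "based_matrix H T" and S: "deletable H T S" and R: "deletable H T R"
  obtains W where "(oper H)\<^sup>*\<^sup>* W (submatrix T (elems T - S))" "(oper H)\<^sup>*\<^sup>* W (submatrix T (elems T - R))"
  | g a b where "S = {g, a}" "R = {g, b}" "a \<noteq> b" "g \<noteq> a" "g \<noteq> b"
      "complementary H T g a" "complementary H T g b"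
proof -
  note common = that(1) and swap = that(2)
  \<comment> \<open>The common reduct is \<open>T\<close> without the whole pair: it is itself one
    of the two results, and the other result reaches it by deleting \<open>a\<close>.\<close>
  have nested: thesis
    if g: "deletable H T {g}" "annihilating H T g \<or> core T g" and "g \<noteq> a" "complementary H T g a"
      and "S = {g} \<and> R = {g, a} \<or> R = {g} \<and> S = {g, a}" for g a
  proof -
    have "deletable H T {a}"
      using complementary_annihilating_core[OF T that(4)] g(2) by (auto simp: deletable_def)
    then have "oper H (submatrix T (elems T - {g, a})) (submatrix T (elems T - {g}))"
      using delete_two[OF T g(1), of "{a}"] that by (simp add: insert_commute)
    then show thesis
      using common[of "submatrix T (elems T - {g, a})"] that(5)
      by (elim disjE conjE) auto
  qed
  show thesis
  proof (cases "S \<inter> R = {}")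
    case True
    then have "oper H (submatrix T (elems T - (S \<union> R))) (submatrix T (elems T - S))"
      "oper H (submatrix T (elems T - (S \<union> R))) (submatrix T (elems T - R))"
      using delete_two[OF T S R] delete_two[OF T R S] by (auto simp: Un_commute)
    then show thesis using common by blast
  next
    case False
    then obtain g where g: "g \<in> S" "g \<in> R" by blast
    have split: "Z = {g} \<and> (annihilating H T g \<or> core T g) \<or>
        (\<exists>a. Z = {g, a} \<and> g \<noteq> a \<and> complementary H T g a)"
      if "deletable H T Z" "g \<in> Z" for Z
      using that pair_containing[OF T] unfolding deletable_def by (metis singletonD)
    have eq: thesis if "S = R"
      using that common by blast
    show thesis
      using split[OF S g(1)] split[OF R g(2)]
    proof (elim disjE exE conjE)
      fix a b assume "S = {g, a}" "R = {g, b}" "g \<noteq> a" "g \<noteq> b"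
        "complementary H T g a" "complementary H T g b"
      then show thesis using swap[of g a b] eq by blast
    qed (use eq nested[of g] S R in blast)+
  qed
qed

end

section \<open>Tribes and primitive reducts\<close>

locale tribal_matrices = based_matrices H for H :: "('h, 'm) monoid_scheme" (structure) +
  fixes T0 :: "('a, 'h) bmatrix" and \<CC> :: "('a, 'h) bmatrix \<Rightarrow> 'a set set"
  assumes infinite_elements: "infinite (UNIV :: 'a set)"
    and based_T0: "based_matrix H T0"
    and tribal: "tribal_system H (homology_class H T0) \<CC>"
begin

abbreviation family :: "('a, 'h) bmatrix set" where
  "family \<equiv> homology_class H T0"

text \<open>Tribes in the form of an equivalence relation on the elements: condition (ii) then
  becomes plain restriction of a relation (\<open>same_oper\<close>), with no correspondence between
  classes to carry along.\<close>

definition same :: "('a, 'h) bmatrix \<Rightarrow> 'a \<Rightarrow> 'a \<Rightarrow> bool" where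
  "same T x y \<longleftrightarrow> (\<exists>C\<in>\<CC> T. x \<in> C \<and> y \<in> C)"

lemma T0_family: "T0 \<in> family"
  unfolding homology_class_def homologous_def chain_def
  by (auto intro!: exI[of _ "[T0]"] simp: based_T0)

lemma family_based: "T \<in> family \<Longrightarrow> based_matrix H T"
  unfolding homology_class_def homologous_def chain_def by auto

lemma family_step:
  assumes "U \<in> family" "oper H U V \<or> oper H V U"
  shows "V \<in> family"
proof -
  obtain Ts where Ts: "chain H T0 Ts U"
    using assms by (auto simp: homology_class_def homologous_def)
  have "chain H T0 (Ts @ [V]) V"
    using Ts assms(2) oper_based[of H U V] oper_based[of H V U]
    by (auto simp: chain_def successively_append_iff)
  then show ?thesis
    by (auto simp: homology_class_def homologous_def)
qed

lemma family_oper: "oper H U T \<Longrightarrow> U \<in> family \<longleftrightarrow> T \<in> family"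
  using family_step by blast

lemma tribes_partition: "T \<in> family \<Longrightarrow> partition_on (elems T) (\<CC> T)"
  using tribal by (simp add: tribal_system_def)

lemma tribes_disjoint:
  "T \<in> family \<Longrightarrow> C \<in> \<CC> T \<Longrightarrow> D \<in> \<CC> T \<Longrightarrow> x \<in> C \<Longrightarrow> x \<in> D \<Longrightarrow> C = D"
  using tribes_partition[of T] by (auto simp: partition_on_def disjoint_def)

lemma same_refl: "T \<in> family \<Longrightarrow> x \<in> elems T \<Longrightarrow> same T x x"
  using tribes_partition[of T] by (auto simp: partition_on_def same_def)

lemma same_sym: "same T x y \<Longrightarrow> same T y x"
  by (auto simp: same_def)

lemma same_trans: "T \<in> family \<Longrightarrow> same T x y \<Longrightarrow> same T y z \<Longrightarrow> same T x z"
  unfolding same_def by (metis tribes_disjoint)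

lemma same_elems: "T \<in> family \<Longrightarrow> same T x y \<Longrightarrow> x \<in> elems T \<and> y \<in> elems T"
  using tribes_partition[of T] by (auto simp: partition_on_def same_def)

lemma same_complementary: "T \<in> family \<Longrightarrow> complementary H T g g' \<Longrightarrow> same T g g'"
  using tribal by (auto simp: tribal_system_def same_def)

lemma tribe_eq_same: "T \<in> family \<Longrightarrow> C \<in> \<CC> T \<Longrightarrow> x \<in> C \<Longrightarrow> C = {y. same T x y}"
  unfolding same_def by (auto dest: tribes_disjoint)

lemma tribe_of: "T \<in> family \<Longrightarrow> x \<in> elems T \<Longrightarrow> {y. same T x y} \<in> \<CC> T"
  using same_refl[of T x] tribe_eq_same[of T] unfolding same_def[of T x x] by metis

lemma tribes_oper:
  assumes "oper H U T" "T \<in> family"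
  shows "\<CC> U = {C \<inter> elems U |C. C \<in> \<CC> T \<and> C \<inter> elems U \<noteq> {}}"
proof -
  have "U \<in> family"
    using assms family_oper by blast
  from tribal[unfolded tribal_system_def, THEN conjunct2, THEN conjunct1, THEN bspec, OF this,
      THEN bspec, OF assms(2), THEN mp, OF assms(1)]
  show ?thesis by (rule conjunct2)
qed

lemma same_oper:
  assumes "oper H U T" "T \<in> family" "x \<in> elems U" "y \<in> elems U"
  shows "same U x y \<longleftrightarrow> same T x y"
proof
  assume "same U x y"
  then show "same T x y"
    unfolding same_def tribes_oper[OF assms(1,2)] by blast
next
  assume "same T x y"
  then obtain C where "C \<in> \<CC> T" "x \<in> C" "y \<in> C"
    by (auto simp: same_def)
  with assms(3,4) have "C \<inter> elems U \<in> \<CC> U" "x \<in> C \<inter> elems U" "y \<in> C \<inter> elems U"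
    unfolding tribes_oper[OF assms(1,2)] by auto
  then show "same U x y"
    unfolding same_def by (intro bexI[of _ "C \<inter> elems U"] conjI)
qed

text \<open>The argument of Newman's lemma, by induction on the size of \<open>T\<close>, with
  equality of normal forms weakened to isomorphism. The clause on \<open>same\<close> is part of the
  induction because the later comparison of embeddings needs the isomorphism to move elements only
  inside their tribes.\<close>

lemma primitive_reducts_isomorphic:
  assumes "T \<in> family" "primitive H P" "(oper H)\<^sup>*\<^sup>* P T" "primitive H Q" "(oper H)\<^sup>*\<^sup>* Q T"
  shows "\<exists>\<phi>. isomorphism \<phi> P Q \<and> (\<forall>x\<in>elems P. same T x (\<phi> x))"
  using assms
proof (induction "card (elems T)" arbitrary: T P Q rule: less_induct)
  case less
  note T = less.prems(1) and P = less.prems(2,3) and Q = less.prems(4,5)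
  have bT: "based_matrix H T" using family_based[OF T] .
  have IH: "\<exists>\<phi>. isomorphism \<phi> A B \<and> (\<forall>x\<in>elems A. same T x (\<phi> x))"
    if UT: "oper H U T" and AB: "primitive H A" "(oper H)\<^sup>*\<^sup>* A U" "primitive H B" "(oper H)\<^sup>*\<^sup>* B U" for U A B
  proof -
    have U: "U \<in> family" "card (elems U) < card (elems T)"
      using family_oper[OF UT] T oper_psubset(3)[OF UT] by auto
    obtain \<phi> where \<phi>: "isomorphism \<phi> A B" "\<forall>x\<in>elems A. same U x (\<phi> x)"
      using less.hyps[OF U(2,1) AB] by blast
    have "same T x (\<phi> x)" if "x \<in> elems A" for x
    proof -
      have "same U x (\<phi> x)" using \<phi> that by blast
      then show ?thesis
        using same_oper[OF UT T] same_elems[OF U(1)] by blast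
    qed
    with \<phi> show ?thesis by blast
  qed
  have compose: "\<exists>\<phi>. isomorphism \<phi> A C \<and> (\<forall>x\<in>elems A. same T x (\<phi> x))"
    if AB: "\<exists>\<phi>. isomorphism \<phi> A B \<and> (\<forall>x\<in>elems A. same T x (\<phi> x))"
      and BC: "\<exists>\<phi>. isomorphism \<phi> B C \<and> (\<forall>x\<in>elems B. same T x (\<phi> x))" for A B C
  proof -
    obtain \<phi> where \<phi>: "isomorphism \<phi> A B" "\<forall>x\<in>elems A. same T x (\<phi> x)"
      using AB by blast
    obtain \<psi> where \<psi>: "isomorphism \<psi> B C" "\<forall>x\<in>elems B. same T x (\<psi> x)"
      using BC by blast
    have "same T x ((\<psi> \<circ> \<phi>) x)" if x: "x \<in> elems A" for x
    proof -
      have "\<phi> x \<in> elems B" using isomorphismD(2)[OF \<phi>(1)] x by blast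
      then show ?thesis
        using \<phi>(2) \<psi>(2) x same_trans[OF T, of x "\<phi> x"] by simp
    qed
    then show ?thesis using isomorphism_comp[OF \<phi>(1) \<psi>(1)] by blast
  qed
  have id: "\<exists>\<phi>. isomorphism \<phi> T T \<and> (\<forall>x\<in>elems T. same T x (\<phi> x))"
    using isomorphism_id same_refl[OF T] by (metis id_apply)
  show ?case
  proof (cases "primitive H T")
    case True
    then have "P = T" "Q = T" using primitive_reduct_eq P Q by blast+
    then show ?thesis using id by simp
  next
    case False
    then obtain U V where U: "(oper H)\<^sup>*\<^sup>* P U" "oper H U T" and V: "(oper H)\<^sup>*\<^sup>* Q V" "oper H V T"
      using P Q by (metis rtranclp.cases)
    obtain S R where S: "deletable H T S" "U = submatrix T (elems T - S)"
      and R: "deletable H T R" "V = submatrix T (elems T - R)"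
      using U(2) V(2) unfolding oper_iff_deletable by blast
    show ?thesis
    proof (rule deletions_confluent[OF bT S(1) R(1)])
      fix W assume W: "(oper H)\<^sup>*\<^sup>* W (submatrix T (elems T - S))" "(oper H)\<^sup>*\<^sup>* W (submatrix T (elems T - R))"
      \<comment> \<open>A primitive reduct \<open>M\<close> of \<open>W\<close> is a reduct of both
        deletions, so the induction hypothesis compares \<open>P\<close> with \<open>M\<close> and
        \<open>M\<close> with \<open>Q\<close>.\<close>
      have "based_matrix H W"
        using reduct_based[OF W(1)] oper_based(1)[OF U(2)] S(2) by blast
      then obtain M where M: "primitive H M" "(oper H)\<^sup>*\<^sup>* M W"
        using exists_primitive_reduct by blast
      then have "(oper H)\<^sup>*\<^sup>* M U" "(oper H)\<^sup>*\<^sup>* M V"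
        using W S R by auto
      then show ?thesis
        using compose[OF IH[OF U(2) P(1) U(1) M(1)] IH[OF V(2) M(1) _ Q(1) V(1)]] by blast
    next
      fix g a b assume ab: "S = {g, a}" "R = {g, b}" "a \<noteq> b" "g \<noteq> a" "g \<noteq> b"
        and c: "complementary H T g a" "complementary H T g b"
      \<comment> \<open>\<open>a\<close> and \<open>b\<close> are both complementary to
        \<open>g\<close>: cancelling the row of \<open>g\<close> gives them equal rows, and both lie
        in the tribe of \<open>g\<close>. Their exchange is therefore an automorphism of
        \<open>T\<close> that respects tribes, and it maps \<open>V\<close> onto
        \<open>U\<close>.\<close>
      let ?w = "id(b := a, a := b)"
      have n: "g \<in> nonbase T" "a \<in> nonbase T" "b \<in> nonbase T"
        using c by (auto simp: complementary_def)
      then have e: "g \<in> elems T" "a \<in> elems T" "b \<in> elems T" "base T \<notin> {g, a, b}"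
        by (auto simp: nonbase_def)
      have "form T (b, h) = form T (a, h)" if "h \<in> elems T" for h
      proof -
        have "form T (g, h) \<otimes> form T (b, h) = form T (g, h) \<otimes> form T (a, h)"
          using c that by (simp add: complementary_def)
        then show ?thesis
          using form_closed[OF bT _ that] e by simp
      qed
      then have iso: "isomorphism ?w T T"
        by (intro swap_automorphism[OF bT n(3,2)])
      have w: "same T x (?w x)" if "x \<in> elems T" for x
      proof -
        have "same T a b"
          using same_complementary[OF T] c same_trans[OF T] same_sym by blast
        then show ?thesis
          using same_refl[OF T that] by (auto dest: same_sym)
      qed
      have im: "?w ` (elems T - R) = elems T - S"
        using ab e by (auto simp: image_iff)
      have bV: "base T \<in> elems T - R" using e ab based_matrixD(2)[OF bT] by auto
      have red: "elems Q \<subseteq> elems T" "base Q = base T" "Q = submatrix T (elems Q)"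
        using reduct_based[OF Q(2) bT] by auto
      \<comment> \<open>The exchanged copy of \<open>Q\<close> is a reduct of \<open>U\<close>,
        where the induction hypothesis compares it with \<open>P\<close>; undoing the exchange leads
        back to \<open>Q\<close>.\<close>
      define Q' where "Q' = submatrix T (?w ` elems Q)"
      have Q'U: "(oper H)\<^sup>*\<^sup>* Q' U"
        using automorphism_reduct[OF bT iso R(2) Diff_subset bV V(1)] im S(2) by (simp add: Q'_def)
      have isoQ: "isomorphism ?w Q Q'"
        using isomorphism_submatrix[OF iso red(1)] red(3) by (simp add: Q'_def)
      have bQ': "based_matrix H Q'"
        using reduct_based[OF Q'U oper_based(1)[OF U(2)]] by simp
      have primQ': "primitive H Q'"
        using isomorphism_primitive[OF isoQ bQ' Q(1)] .
      have "isomorphism (inv_into (elems Q) ?w) Q' Q"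
        using isomorphism_inv[OF isoQ] Q(1) based_matrixD(2) by (auto simp: primitive_def)
      moreover have "same T x (inv_into (elems Q) ?w x)" if "x \<in> elems Q'" for x
      proof -
        have "inv_into (elems Q) ?w x \<in> elems Q" "?w (inv_into (elems Q) ?w x) = x"
          using that isomorphismD(2)[OF isoQ] by (metis inv_into_into, metis f_inv_into_f)
        then show ?thesis
          using w red(1) same_sym by (metis subsetD)
      qed
      ultimately show ?thesis
        using compose[OF IH[OF U(2) P(1) U(1) primQ' Q'U]] by blast
    qed
  qed
qed

end

section \<open>Chains, and the finest invariant partition\<close>

lemma chain_single: "chain H T [U] T' \<longleftrightarrow> U = T \<and> T' = T \<and> based_matrix H T"
  by (auto simp: chain_def)

lemma chain_Cons_Cons:
  "chain H T (U # V # Ts) T' \<longleftrightarrow>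
    U = T \<and> based_matrix H T \<and> (oper H T V \<or> oper H V T) \<and> chain H V (V # Ts) T'"
  by (auto simp: chain_def)

lemma chain_ConsE:
  assumes "chain H T Ts T'"
  obtains Us where "Ts = T # Us"
  using assms by (cases Ts) (auto simp: chain_def)

context tribal_matrices
begin

lemma chain_family_iff:
  assumes "chain H T Ts T'"
  shows "T \<in> family \<longleftrightarrow> T' \<in> family"
  using assms
proof (induction Ts arbitrary: T)
  case (Cons U Ts)
  show ?case
  proof (cases Ts)
    case Nil
    with Cons.prems show ?thesis by (simp add: chain_single)
  next
    case (Cons V Vs)
    with Cons.prems Cons.IH[of V] show ?thesis
      using family_step[of T V] family_step[of V T] by (auto simp: chain_Cons_Cons)
  qed
qed (simp add: chain_def)

text \<open>The induction principle of the homology class. The step is an equivalence because chains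
  use operations in both directions; the two matrices are connected through
  \<open>T0\<close>.\<close>

lemma family_invariant:
  assumes "T \<in> family" "T' \<in> family"
    and step: "\<And>U V. V \<in> family \<Longrightarrow> oper H U V \<Longrightarrow> Q U \<longleftrightarrow> Q V"
  shows "Q T \<longleftrightarrow> Q T'"
proof -
  have "Q U \<longleftrightarrow> Q V" if "chain H U Ts V" "U \<in> family" for U V Ts
    using that
  proof (induction Ts arbitrary: U)
    case (Cons W Ts)
    show ?case
    proof (cases Ts)
      case Nil
      with Cons.prems show ?thesis by (simp add: chain_single)
    next
      case (Cons X Xs)
      with Cons.prems have X: "chain H X Ts V" "oper H U X \<or> oper H X U" "X \<in> family"
        using family_step[of U X] by (auto simp: chain_Cons_Cons)
      then show ?thesis
        using Cons.IH[OF X(1,3)] step Cons.prems(2) by blast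
    qed
  qed (simp add: chain_def)
  moreover obtain Ts Us where "chain H T0 Ts T" "chain H T0 Us T'"
    using assms(1,2) by (auto simp: homology_class_def homologous_def)
  ultimately show ?thesis
    using T0_family by blast
qed

text \<open>The finest invariant partition is the common refinement of all of them; the one-block
  partition shows that there is at least one. An intersection of unions of tribes is again a union
  of tribes, and invariance passes to intersections. Uniqueness is antisymmetry of
  refinement.\<close>

lemma bar_partition_invariant:
  assumes T: "T \<in> family"
  shows "invariant_partition \<CC> T (bar_partition \<CC> T)"
proof -
  define \<P> where "\<P> = {Q. invariant_partition \<CC> T Q}"
  define R where "R = common_refinement \<P>"
  have aut: "\<psi> ` elems T = elems T \<and> inj_on \<psi> (elems T)" if "\<psi> \<in> automorphisms T" for \<psi>
    using that by (auto simp: automorphisms_def bij_betw_def)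
  have fin: "finite (elems T)" and ne: "elems T \<noteq> {}"
    using based_matrixD(1,2)[OF family_based[OF T]] by auto
  have un: "elems T = \<Union> (\<CC> T)"
    using tribes_partition[OF T] by (simp add: partition_on_def)
  have "invariant_partition \<CC> T {elems T}"
    using aut un ne by (auto simp: invariant_partition_def partition_on_def)
  then have P: "\<P> \<noteq> {}" by (auto simp: \<P>_def)
  have part: "partition_on (elems T) Q" if "Q \<in> \<P>" for Q
    using that by (simp add: \<P>_def invariant_partition_def)
  have partR: "partition_on (elems T) R"
    unfolding R_def using P part by (intro partition_on_common_refinement) auto
  have inv: "invariant_partition \<CC> T R"
    unfolding invariant_partition_def
  proof (intro conjI ballI partR)
    fix D assume D: "D \<in> R"
    then obtain f where f: "f \<in> (\<Pi> Q\<in>\<P>. Q)" "D = \<Inter> (f ` \<P>)"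
      unfolding R_def common_refinement by blast
    have DT: "D \<subseteq> elems T"
      using partR D by (auto simp: partition_on_def)
    have blocks: "(\<exists>\<K>\<subseteq>\<CC> T. f Q = \<Union>\<K>) \<and> (\<forall>\<psi>\<in>automorphisms T. \<psi> ` f Q = f Q)" if "Q \<in> \<P>" for Q
    proof -
      have "f Q \<in> Q" "invariant_partition \<CC> T Q"
        using f(1) that by (auto simp: \<P>_def Pi_iff)
      then show ?thesis by (simp add: invariant_partition_def)
    qed
    have un_tribes: "D = \<Union> {C \<in> \<CC> T. C \<subseteq> D}"
    proof
      show "D \<subseteq> \<Union> {C \<in> \<CC> T. C \<subseteq> D}"
      proof
        fix x assume x: "x \<in> D"
        then obtain C where C: "C \<in> \<CC> T" "x \<in> C" using DT un by blast
        have "C \<subseteq> f Q" if Q: "Q \<in> \<P>" for Q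
        proof -
          obtain \<K> where K: "\<K> \<subseteq> \<CC> T" "f Q = \<Union>\<K>"
            using blocks[OF Q] by blast
          have "x \<in> \<Union>\<K>" using x f(2) Q K(2) by blast
          then show ?thesis using tribes_disjoint[OF T C(1) _ C(2)] K by blast
        qed
        then have "C \<subseteq> D" using f(2) by blast
        with C show "x \<in> \<Union> {C \<in> \<CC> T. C \<subseteq> D}" by blast
      qed
    qed auto
    show "\<exists>\<K>\<subseteq>\<CC> T. D = \<Union>\<K>"
      by (intro exI[of _ "{C \<in> \<CC> T. C \<subseteq> D}"] conjI un_tribes Collect_restrict)
    fix \<psi> assume psi: "\<psi> \<in> automorphisms T"
    have "\<psi> ` D \<subseteq> D"
    proof
      fix y assume "y \<in> \<psi> ` D"
      then obtain x where x: "x \<in> D" "y = \<psi> x" by blast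
      have "y \<in> f Q" if "Q \<in> \<P>" for Q
      proof -
        have "x \<in> f Q" "\<psi> ` f Q = f Q" using x(1) f(2) that blocks[OF that] psi by blast+
        then show ?thesis using x(2) by blast
      qed
      then show "y \<in> D" using f(2) by blast
    qed
    \<comment> \<open>The map is injective and \<open>D\<close> is finite, so the inclusion just
      proved is an equality.\<close>
    moreover have "card (\<psi> ` D) = card D"
      using aut[OF psi] DT by (intro card_image) (auto intro: inj_on_subset)
    ultimately show "\<psi> ` D = D"
      using fin DT by (simp add: card_subset_eq finite_subset)
  qed
  have fine: "refines (elems T) R Q" if "invariant_partition \<CC> T Q" for Q
    unfolding R_def using part that by (intro refines_common_refinement) (auto simp: \<P>_def)
  have "bar_partition \<CC> T = R"
    unfolding bar_partition_def
  proof (rule the_equality)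
    fix Q assume "invariant_partition \<CC> T Q \<and> (\<forall>Q'. invariant_partition \<CC> T Q' \<longrightarrow> refines (elems T) Q Q')"
    then show "Q = R" using inv fine refines_asym by metis
  qed (use inv fine in blast)
  then show ?thesis using inv by simp
qed

end

section \<open>The coarsened partition\<close>

locale primitive_representative = tribal_matrices H T0 \<CC>
  for H :: "('h, 'm) monoid_scheme" (structure) and T0 :: "('a, 'h) bmatrix" and \<CC> +
  fixes P :: "('a, 'h) bmatrix"
  assumes primitive_P: "primitive H P" and homologous_P: "homologous H T0 P"
begin

text \<open>
  Tribal systems are not assumed to be invariant under isomorphism, so the second clause is
  recorded separately; chains of operations preserve it.
\<close>

definition marking :: "('a, 'h) bmatrix \<Rightarrow> ('a \<Rightarrow> 'a) \<Rightarrow> bool" where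
  "marking T \<phi> \<longleftrightarrow> (\<exists>R. primitive H R \<and> (oper H)\<^sup>*\<^sup>* R T \<and> isomorphism \<phi> P R) \<and>
     (\<forall>x\<in>elems P. \<forall>y\<in>elems P. same P x y \<longleftrightarrow> same T (\<phi> x) (\<phi> y))"

text \<open>A description, free of chains, of the class that corresponds to a block \<open>D\<close>
  of \<open>P\<close>: the union of the tribes met by \<open>D\<close> under embeddings of
  \<open>P\<close> as a primitive reduct. Admitting all markings avoids a choice;
  \<open>bar_class_eq\<close> shows that any single one gives the same set.\<close>

definition bar_class :: "('a, 'h) bmatrix \<Rightarrow> 'a set \<Rightarrow> 'a set" where
  "bar_class T D = {y. \<exists>\<phi>. marking T \<phi> \<and> (\<exists>x\<in>D. same T y (\<phi> x))}"

abbreviation blocks :: "'a set set" where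
  "blocks \<equiv> bar_partition \<CC> P"

lemma P_family: "P \<in> family"
  using homologous_P by (simp add: homology_class_def)

lemma blocks_partition: "partition_on (elems P) blocks"
  using bar_partition_invariant[OF P_family] by (simp add: invariant_partition_def)

lemma blocks_automorphism: "D \<in> blocks \<Longrightarrow> \<alpha> \<in> automorphisms P \<Longrightarrow> \<alpha> ` D = D"
  using bar_partition_invariant[OF P_family] by (simp add: invariant_partition_def)

lemma blocks_subset: "D \<in> blocks \<Longrightarrow> D \<subseteq> elems P"
  using blocks_partition by (auto simp: partition_on_def)

lemma blocks_nonempty: "D \<in> blocks \<Longrightarrow> D \<noteq> {}"
  using blocks_partition by (auto simp: partition_on_def)

lemma blocks_disjoint: "D \<in> blocks \<Longrightarrow> E \<in> blocks \<Longrightarrow> x \<in> D \<Longrightarrow> x \<in> E \<Longrightarrow> D = E"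
  using blocks_partition by (auto simp: partition_on_def disjoint_def)

lemma blocks_cover: "x \<in> elems P \<Longrightarrow> \<exists>D\<in>blocks. x \<in> D"
  using blocks_partition by (auto simp: partition_on_def)

lemma finite_blocks: "finite blocks"
  using blocks_partition based_matrixD(1)[OF family_based[OF P_family]] finite_elements by blast

lemma blocks_same:
  assumes D: "D \<in> blocks" and x: "x \<in> D" and s: "same P x y"
  shows "y \<in> D"
proof -
  obtain \<K> where K: "\<K> \<subseteq> \<CC> P" "D = \<Union>\<K>"
    using bar_partition_invariant[OF P_family] D by (auto simp: invariant_partition_def)
  then obtain C where C: "C \<in> \<K>" "x \<in> C" using x by blast
  obtain C' where C': "C' \<in> \<CC> P" "x \<in> C'" "y \<in> C'" using s by (auto simp: same_def)
  have "C = C'"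
    using tribes_disjoint[OF P_family, of C C' x] C C' K by blast
  then show ?thesis using C C' K by blast
qed

lemma marking_P: "marking P id"
  unfolding marking_def using primitive_P isomorphism_id by auto

lemma marking_elems: "T \<in> family \<Longrightarrow> marking T \<phi> \<Longrightarrow> x \<in> elems P \<Longrightarrow> \<phi> x \<in> elems T"
  unfolding marking_def
  using reduct_based[OF _ family_based] isomorphismD(2) by blast

lemma marking_oper:
  assumes UT: "oper H U T" and T: "T \<in> family" and m: "marking U \<phi>"
  shows "marking T \<phi>"
proof -
  have U: "U \<in> family" using family_oper[OF UT] T by simp
  obtain R where R: "primitive H R" "(oper H)\<^sup>*\<^sup>* R U" "isomorphism \<phi> P R"
    using m by (auto simp: marking_def)
  have "(oper H)\<^sup>*\<^sup>* R T" using R(2) UT by simp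
  moreover have "same P x y \<longleftrightarrow> same T (\<phi> x) (\<phi> y)" if "x \<in> elems P" "y \<in> elems P" for x y
    using m that same_oper[OF UT T] marking_elems[OF U m] by (simp add: marking_def)
  ultimately show ?thesis using R by (auto simp: marking_def)
qed

text \<open>Markings pass upwards unchanged. Downwards, the reduct of \<open>V\<close> marked by
  \<open>\<phi>\<close> may use elements missing from \<open>U\<close>; it is replaced by a
  primitive reduct of \<open>U\<close>, which is also one of \<open>V\<close>, and
  \<open>\<phi>\<close> is composed with the isomorphism between the two. That isomorphism stays
  inside tribes of \<open>V\<close>, so the second clause of \<open>marking\<close> is
  preserved.\<close>

lemma marking_exists:
  assumes "T \<in> family"
  shows "\<exists>\<phi>. marking T \<phi>"
proof -
  have "(\<exists>\<phi>. marking U \<phi>) \<longleftrightarrow> (\<exists>\<phi>. marking V \<phi>)" if V: "V \<in> family" and UV: "oper H U V" for U V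
  proof
    show "\<exists>\<phi>. marking U \<phi> \<Longrightarrow> \<exists>\<phi>. marking V \<phi>"
      using marking_oper[OF UV V] by blast
    assume "\<exists>\<phi>. marking V \<phi>"
    then obtain \<phi> R where m: "marking V \<phi>" and R: "primitive H R" "(oper H)\<^sup>*\<^sup>* R V" "isomorphism \<phi> P R"
      unfolding marking_def by blast
    obtain R' where R': "primitive H R'" "(oper H)\<^sup>*\<^sup>* R' U"
      using exists_primitive_reduct[OF oper_based(1)[OF UV]] by blast
    then have R'V: "(oper H)\<^sup>*\<^sup>* R' V" using UV by simp
    obtain \<chi> where chi: "isomorphism \<chi> R R'" "\<forall>x\<in>elems R. same V x (\<chi> x)"
      using primitive_reducts_isomorphic[OF V R(1,2) R'(1) R'V] by blast
    have U: "U \<in> family" using family_oper[OF UV] V by simp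
    have "same P x y \<longleftrightarrow> same U ((\<chi> \<circ> \<phi>) x) ((\<chi> \<circ> \<phi>) y)" if xy: "x \<in> elems P" "y \<in> elems P" for x y
    proof -
      have R: "\<phi> x \<in> elems R" "\<phi> y \<in> elems R"
        using xy isomorphismD(2)[OF R(3)] by auto
      then have "\<chi> (\<phi> x) \<in> elems R'" "\<chi> (\<phi> y) \<in> elems R'"
        using isomorphismD(2)[OF chi(1)] by auto
      then have E: "\<chi> (\<phi> x) \<in> elems U" "\<chi> (\<phi> y) \<in> elems U"
        using reduct_based[OF R'(2) family_based[OF U]] by auto
      have "same V (\<phi> x) (\<chi> (\<phi> x))" "same V (\<phi> y) (\<chi> (\<phi> y))"
        using chi(2) R by auto
      then have "same V (\<phi> x) (\<phi> y) \<longleftrightarrow> same V (\<chi> (\<phi> x)) (\<chi> (\<phi> y))"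
        using same_trans[OF V] same_sym by blast
      then show ?thesis
        using m xy same_oper[OF UV V E] by (simp add: marking_def)
    qed
    then have "marking U (\<chi> \<circ> \<phi>)"
      unfolding marking_def using R' isomorphism_comp[OF R(3) chi(1)] by blast
    then show "\<exists>\<phi>. marking U \<phi>" by blast
  qed
  then show ?thesis
    using family_invariant[OF assms P_family, of "\<lambda>U. \<exists>\<phi>. marking U \<phi>"] marking_P by metis
qed

text \<open>The two image reducts are isomorphic inside the tribes of \<open>T\<close>; going out by
  \<open>\<phi>\<close>, across by this isomorphism and back by the inverse of \<open>\<psi>\<close>
  is an automorphism of \<open>P\<close>.\<close>

lemma marking_unique:
  assumes T: "T \<in> family" and m: "marking T \<phi>" "marking T \<psi>"
  shows "\<exists>\<alpha>\<in>automorphisms P. \<forall>x\<in>elems P. same T (\<phi> x) (\<psi> (\<alpha> x))"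
proof -
  obtain R where R: "primitive H R" "(oper H)\<^sup>*\<^sup>* R T" "isomorphism \<phi> P R"
    using m(1) by (auto simp: marking_def)
  obtain S where S: "primitive H S" "(oper H)\<^sup>*\<^sup>* S T" "isomorphism \<psi> P S"
    using m(2) by (auto simp: marking_def)
  obtain \<chi> where chi: "isomorphism \<chi> R S" "\<forall>x\<in>elems R. same T x (\<chi> x)"
    using primitive_reducts_isomorphic[OF T R(1,2) S(1,2)] by blast
  define \<alpha> where "\<alpha> = inv_into (elems P) \<psi> \<circ> (\<chi> \<circ> \<phi>)"
  have sP: "base P \<in> elems P" using based_matrixD(2)[OF family_based[OF P_family]] .
  have "isomorphism \<alpha> P P"
    unfolding \<alpha>_def
    by (rule isomorphism_comp[OF isomorphism_comp[OF R(3) chi(1)] isomorphism_inv[OF S(3) sP]])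
  moreover have "same T (\<phi> x) (\<psi> (\<alpha> x))" if x: "x \<in> elems P" for x
  proof -
    have R: "\<phi> x \<in> elems R" using x isomorphismD(2)[OF R(3)] by auto
    then have "\<chi> (\<phi> x) \<in> \<psi> ` elems P"
      using isomorphismD(2)[OF chi(1)] isomorphismD(2)[OF S(3)] by auto
    then have "\<psi> (\<alpha> x) = \<chi> (\<phi> x)"
      by (simp add: \<alpha>_def f_inv_into_f)
    then show ?thesis using chi(2) R by simp
  qed
  ultimately show ?thesis by (auto simp: automorphisms_eq)
qed

text \<open>This is where the automorphism invariance of blocks is used: a change of marking
  replaces \<open>x\<close> by \<open>\<alpha> x\<close>, which stays in \<open>D\<close>.\<close>

lemma bar_class_eq:
  assumes T: "T \<in> family" and m: "marking T \<phi>" and D: "D \<in> blocks"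
  shows "bar_class T D = {y. \<exists>x\<in>D. same T y (\<phi> x)}"
proof -
  have "\<exists>x\<in>D. same T y (\<phi> x)" if psi: "marking T \<psi>" and x: "x \<in> D" and y: "same T y (\<psi> x)" for y \<psi> x
  proof -
    obtain \<alpha> where a: "\<alpha> \<in> automorphisms P" "\<forall>x\<in>elems P. same T (\<psi> x) (\<phi> (\<alpha> x))"
      using marking_unique[OF T psi m] by blast
    have "\<alpha> x \<in> D" using blocks_automorphism[OF D a(1)] x by blast
    moreover have "same T y (\<phi> (\<alpha> x))"
      using same_trans[OF T y] a(2) x blocks_subset[OF D] by blast
    ultimately show ?thesis by blast
  qed
  then show ?thesis unfolding bar_class_def using m by blast
qed

lemma bar_class_same: "T \<in> family \<Longrightarrow> y \<in> bar_class T D \<Longrightarrow> same T y z \<Longrightarrow> z \<in> bar_class T D"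
  unfolding bar_class_def using same_trans same_sym by blast

lemma bar_class_subset: "T \<in> family \<Longrightarrow> bar_class T D \<subseteq> elems T"
  unfolding bar_class_def using same_elems by blast

lemma marking_bar_class:
  "T \<in> family \<Longrightarrow> marking T \<phi> \<Longrightarrow> D \<in> blocks \<Longrightarrow> x \<in> D \<Longrightarrow> \<phi> x \<in> bar_class T D"
  unfolding bar_class_def using same_refl marking_elems blocks_subset by blast

lemma bar_class_nonempty: "T \<in> family \<Longrightarrow> D \<in> blocks \<Longrightarrow> bar_class T D \<noteq> {}"
  using marking_exists marking_bar_class blocks_nonempty by blast

lemma bar_class_disjoint:
  assumes T: "T \<in> family" and DE: "D \<in> blocks" "E \<in> blocks"
    and y: "y \<in> bar_class T D" "y \<in> bar_class T E"
  shows "D = E"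
proof -
  obtain \<phi> where m: "marking T \<phi>" using marking_exists[OF T] by blast
  obtain x where x: "x \<in> D" "same T y (\<phi> x)"
    using y(1) unfolding bar_class_eq[OF T m DE(1)] by blast
  obtain z where z: "z \<in> E" "same T y (\<phi> z)"
    using y(2) unfolding bar_class_eq[OF T m DE(2)] by blast
  have "same T (\<phi> x) (\<phi> z)"
    using same_trans[OF T same_sym[OF x(2)] z(2)] .
  \<comment> \<open>The second clause of \<open>marking\<close> reflects the relation back from
    \<open>T\<close> to \<open>P\<close>.\<close>
  then have "same P x z"
    using m x(1) z(1) blocks_subset[OF DE(1)] blocks_subset[OF DE(2)] by (auto simp: marking_def)
  then show ?thesis
    using blocks_disjoint[OF DE blocks_same[OF DE(1) x(1)] z(1)] by simp
qed

lemma inj_bar_class: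
  assumes T: "T \<in> family"
  shows "inj_on (bar_class T) blocks"
proof (rule inj_onI)
  fix D E assume DE: "D \<in> blocks" "E \<in> blocks" "bar_class T D = bar_class T E"
  obtain y where "y \<in> bar_class T D" using bar_class_nonempty[OF T DE(1)] by blast
  then show "D = E" using bar_class_disjoint[OF T DE(1,2)] DE(3) by simp
qed

lemma bar_class_P:
  assumes D: "D \<in> blocks"
  shows "bar_class P D = D"
proof -
  have "{y. \<exists>x\<in>D. same P y x} = D"
    using blocks_same[OF D] same_sym same_refl[OF P_family] blocks_subset[OF D] by blast
  then show ?thesis
    unfolding bar_class_eq[OF P_family marking_P D] id_apply by simp
qed

text \<open>A marking of the smaller matrix is also one of the larger, so both classes can be
  computed with the same map.\<close>

lemma bar_class_oper:
  assumes UT: "oper H U T" and T: "T \<in> family" and D: "D \<in> blocks"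
  shows "bar_class U D = bar_class T D \<inter> elems U"
proof -
  have U: "U \<in> family" using family_oper[OF UT] T by simp
  obtain \<phi> where m: "marking U \<phi>" using marking_exists[OF U] by blast
  have "same U y (\<phi> x) \<longleftrightarrow> same T y (\<phi> x) \<and> y \<in> elems U" if "x \<in> D" for x y
    using same_oper[OF UT T _ marking_elems[OF U m]] same_elems[OF U] blocks_subset[OF D] that by blast
  then show ?thesis
    unfolding bar_class_eq[OF U m D] bar_class_eq[OF T marking_oper[OF UT T m] D] by blast
qed

section \<open>Primitive tribes and their transport\<close>

text \<open>Any two primitive reducts meet the same tribes, since they are isomorphic inside tribes;
  so it is enough to look at the image of one marking.\<close>

lemma prim_tribes_iff:
  assumes T: "T \<in> family" and m: "marking T \<phi>"
  shows "C \<in> prim_tribes H \<CC> T \<longleftrightarrow> C \<in> \<CC> T \<and> (\<exists>x\<in>elems P. \<phi> x \<in> C)"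
proof -
  obtain R where R: "primitive H R" "(oper H)\<^sup>*\<^sup>* R T" "isomorphism \<phi> P R"
    using m by (auto simp: marking_def)
  have im: "elems R = \<phi> ` elems P" using isomorphismD(2)[OF R(3)] by simp
  have "\<exists>x\<in>elems P. \<phi> x \<in> C"
    if C: "C \<in> \<CC> T" and S: "primitive H S" "(oper H)\<^sup>*\<^sup>* S T" and z: "z \<in> C" "z \<in> elems S" for S z
  proof -
    obtain \<chi> where chi: "isomorphism \<chi> S R" "\<forall>x\<in>elems S. same T x (\<chi> x)"
      using primitive_reducts_isomorphic[OF T S R(1,2)] by blast
    have in_C: "\<chi> z \<in> C" using chi(2) z tribe_eq_same[OF T C z(1)] by blast
    have "\<chi> z \<in> \<phi> ` elems P" using isomorphismD(2)[OF chi(1)] z(2) im by blast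
    then obtain x where "x \<in> elems P" "\<chi> z = \<phi> x" by blast
    with in_C show ?thesis by auto
  qed
  moreover have "C \<inter> elems R \<noteq> {}" if "x \<in> elems P" "\<phi> x \<in> C" for x
    using that im by blast
  ultimately show ?thesis
    unfolding prim_tribes_def primitive_tribe_def mem_Collect_eq using R(1,2) by blast
qed

definition tribes_in :: "('a, 'h) bmatrix \<Rightarrow> 'a set \<Rightarrow> 'a set set" where
  "tribes_in T D = {C \<in> prim_tribes H \<CC> T. C \<subseteq> bar_class T D}"

text \<open>Each tribe that meets the class of \<open>D\<close> contains a marked point
  \<open>\<phi> x\<close> with x in \<open>D\<close>. It is therefore primitive and lies inside the
  class.\<close>

lemma tribes_in_iff:
  assumes T: "T \<in> family" and D: "D \<in> blocks"
  shows "C \<in> tribes_in T D \<longleftrightarrow> C \<in> \<CC> T \<and> (\<exists>y\<in>C. y \<in> bar_class T D)"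
proof -
  obtain \<phi> where m: "marking T \<phi>" using marking_exists[OF T] by blast
  have "C \<in> tribes_in T D" if C: "C \<in> \<CC> T" "y \<in> C" "y \<in> bar_class T D" for y
  proof -
    obtain x where x: "x \<in> D" "same T y (\<phi> x)" using C bar_class_eq[OF T m D] by blast
    then have "\<phi> x \<in> C" using tribe_eq_same[OF T C(1,2)] by blast
    then have "C \<in> prim_tribes H \<CC> T"
      using prim_tribes_iff[OF T m] C x blocks_subset[OF D] by blast
    moreover have "C \<subseteq> bar_class T D"
      using bar_class_same[OF T C(3)] tribe_eq_same[OF T C(1,2)] by blast
    ultimately show ?thesis by (simp add: tribes_in_def)
  qed
  moreover have "C \<noteq> {}" if "C \<in> \<CC> T"
    using tribes_partition[OF T] that by (auto simp: partition_on_def)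
  moreover have "C \<in> \<CC> T" if "C \<in> prim_tribes H \<CC> T"
    using that by (simp add: prim_tribes_def primitive_tribe_def)
  ultimately show ?thesis unfolding tribes_in_def by blast
qed

lemma Union_tribes_in:
  assumes T: "T \<in> family" and D: "D \<in> blocks"
  shows "\<Union> (tribes_in T D) = bar_class T D"
proof
  show "bar_class T D \<subseteq> \<Union> (tribes_in T D)"
  proof
    fix y assume y: "y \<in> bar_class T D"
    then have "y \<in> elems T" using bar_class_subset[OF T] by blast
    then have "{z. same T y z} \<in> \<CC> T" "y \<in> {z. same T y z}"
      using tribe_of[OF T] same_refl[OF T] by auto
    then show "y \<in> \<Union> (tribes_in T D)" using tribes_in_iff[OF T D] y by blast
  qed
qed (auto simp: tribes_in_def)

lemma prim_tribes_eq:
  assumes T: "T \<in> family"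
  shows "prim_tribes H \<CC> T = \<Union> (tribes_in T ` blocks)"
proof -
  obtain \<phi> where m: "marking T \<phi>" using marking_exists[OF T] by blast
  have "\<exists>D\<in>blocks. C \<in> tribes_in T D" if C: "C \<in> prim_tribes H \<CC> T" for C
  proof -
    obtain x where x: "x \<in> elems P" "\<phi> x \<in> C" "C \<in> \<CC> T" using C prim_tribes_iff[OF T m] by blast
    obtain D where D: "D \<in> blocks" "x \<in> D" using blocks_cover x by blast
    show ?thesis
      using tribes_in_iff[OF T D(1)] marking_bar_class[OF T m D] x D by blast
  qed
  then show ?thesis by (auto simp: tribes_in_def)
qed

lemma restrict_tribes_in:
  assumes UT: "oper H U T" and T: "T \<in> family" and D: "D \<in> blocks"
  shows "(\<lambda>C. C \<inter> elems U) ` tribes_in T D = tribes_in U D"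
proof -
  have U: "U \<in> family" using family_oper[OF UT] T by simp
  obtain \<phi> where m: "marking U \<phi>" using marking_exists[OF U] by blast
  have "C \<inter> elems U \<in> tribes_in U D" if C: "C \<in> tribes_in T D" for C
  proof -
    have CT: "C \<in> \<CC> T" "C \<subseteq> bar_class T D" "C \<in> prim_tribes H \<CC> T"
      using C tribes_in_iff[OF T D] by (auto simp: tribes_in_def)
    obtain x where x: "x \<in> elems P" "\<phi> x \<in> C"
      using CT(3) prim_tribes_iff[OF T marking_oper[OF UT T m]] by blast
    have xU: "\<phi> x \<in> elems U" using marking_elems[OF U m x(1)] .
    have "C \<inter> elems U \<in> \<CC> U"
      using tribes_oper[OF UT T] CT(1) x xU by blast
    moreover have "\<phi> x \<in> bar_class U D"
      using bar_class_oper[OF UT T D] CT(2) x xU by blast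
    ultimately show ?thesis using tribes_in_iff[OF U D] x(2) xU by blast
  qed
  moreover have "C \<in> (\<lambda>C. C \<inter> elems U) ` tribes_in T D" if C: "C \<in> tribes_in U D" for C
  proof -
    obtain y where y: "C \<in> \<CC> U" "y \<in> C" "y \<in> bar_class U D"
      using C tribes_in_iff[OF U D] by blast
    then obtain C' where C': "C' \<in> \<CC> T" "C = C' \<inter> elems U"
      using tribes_oper[OF UT T] by blast
    have "C' \<in> tribes_in T D"
      using tribes_in_iff[OF T D] C' y bar_class_oper[OF UT T D] by blast
    with C' show ?thesis by blast
  qed
  ultimately show ?thesis by blast
qed

text \<open>A primitive tribe of \<open>T\<close> contains a marked point that already belongs to
  \<open>U\<close>, so its trace on \<open>U\<close> is nonempty and determines it.\<close>

lemma inj_restrict_prim_tribes: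
  assumes UT: "oper H U T" and T: "T \<in> family"
  shows "inj_on (\<lambda>C. C \<inter> elems U) (prim_tribes H \<CC> T)"
proof (rule inj_onI)
  have U: "U \<in> family" using family_oper[OF UT] T by simp
  obtain \<phi> where m: "marking U \<phi>" using marking_exists[OF U] by blast
  fix C C' assume C: "C \<in> prim_tribes H \<CC> T" "C' \<in> prim_tribes H \<CC> T" "C \<inter> elems U = C' \<inter> elems U"
  obtain x where x: "x \<in> elems P" "\<phi> x \<in> C" "C \<in> \<CC> T" "C' \<in> \<CC> T"
    using C(1,2) prim_tribes_iff[OF T marking_oper[OF UT T m]] by blast
  have "\<phi> x \<in> C'" using C(3) x(2) marking_elems[OF U m x(1)] by blast
  then show "C = C'" using tribes_disjoint[OF T x(3,4,2)] by simp
qed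

lemma tribe_map_tribes_in:
  assumes UV: "oper H U V \<or> oper H V U" and U: "U \<in> family" and D: "D \<in> blocks"
  shows "tribe_map H \<CC> U V ` tribes_in U D = tribes_in V D"
proof (cases "oper H V U")
  case True
  then show ?thesis
    using restrict_tribes_in[OF True U D] by (simp add: tribe_map_def)
next
  case False
  with UV have UV: "oper H U V" by simp
  then have V: "V \<in> family" using family_oper U by blast
  have "tribes_in V D \<subseteq> prim_tribes H \<CC> V" by (auto simp: tribes_in_def)
  then have "inv_into (prim_tribes H \<CC> V) (\<lambda>C. C \<inter> elems U) ` (\<lambda>C. C \<inter> elems U) ` tribes_in V D = tribes_in V D"
    by (rule inv_into_image_cancel[OF inj_restrict_prim_tribes[OF UV V]])
  then show ?thesis
    using False restrict_tribes_in[OF UV V D] by (simp add: tribe_map_def)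
qed

text \<open>The right-hand side does not mention \<open>Ts\<close>. This is the independence of the
  chain that the definite description in \<open>bar_prim\<close> relies on.\<close>

lemma transport_eq:
  assumes "chain H T Ts P"
  shows "transport H \<CC> Ts (bar_tribe_partition H \<CC> P) = tribes_in T ` blocks"
  using assms
proof (induction Ts arbitrary: T)
  case (Cons U Ts)
  show ?case
  proof (cases Ts)
    case Nil
    with Cons.prems have "U = P" "T = P" by (auto simp: chain_single)
    moreover have "tribes_in P D = {C \<in> prim_tribes H \<CC> P. C \<subseteq> D}" if "D \<in> blocks" for D
      using that by (simp add: tribes_in_def bar_class_P)
    then have "bar_tribe_partition H \<CC> P = tribes_in P ` blocks"
      unfolding bar_tribe_partition_def by auto
    ultimately show ?thesis using Nil by simp
  next
    case (Cons V Vs)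
    with Cons.prems have V: "chain H V Ts P" "oper H V T \<or> oper H T V" "U = T"
      by (auto simp: chain_Cons_Cons)
    have Vf: "V \<in> family" using chain_family_iff[OF V(1)] P_family by simp
    have "transport H \<CC> (U # Ts) (bar_tribe_partition H \<CC> P) =
        (\<lambda>\<K>. tribe_map H \<CC> V T ` \<K>) ` tribes_in V ` blocks"
      using Cons.IH[OF V(1)] V(3) Cons by simp
    also have "\<dots> = tribes_in T ` blocks"
      unfolding image_image using tribe_map_tribes_in[OF V(2) Vf] by (intro image_cong) auto
    finally show ?thesis .
  qed
qed (simp add: chain_def)

lemma chain_exists:
  assumes "T \<in> family"
  shows "\<exists>Ts. chain H T Ts P"
proof -
  have "\<exists>Us. chain H V Us P" if U: "chain H U Ts P" "oper H U V \<or> oper H V U" for U V Ts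
  proof -
    have V: "based_matrix H V" using U(2) oper_based by blast
    have "chain H V (V # Ts) P"
    proof -
      obtain Us where "Ts = U # Us" using chain_ConsE[OF U(1)] .
      then show ?thesis using U V by (auto simp: chain_Cons_Cons)
    qed
    then show ?thesis by blast
  qed
  then have "(\<exists>Ts. chain H U Ts P) \<longleftrightarrow> (\<exists>Ts. chain H V Ts P)" if "oper H U V" for U V
    using that by blast
  moreover have "chain H P [P] P"
    using family_based[OF P_family] by (simp add: chain_single)
  ultimately show ?thesis
    using family_invariant[OF assms P_family, of "\<lambda>U. \<exists>Ts. chain H U Ts P"] by metis
qed

lemma bar_prim_eq:
  assumes T: "T \<in> family"
  shows "bar_prim H \<CC> P T = bar_class T ` blocks"
proof -
  have "(THE \<Q>. \<exists>Ts. chain H T Ts P \<and> \<Q> = transport H \<CC> Ts (bar_tribe_partition H \<CC> P))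
      = tribes_in T ` blocks"
    using chain_exists[OF T] transport_eq by (intro the_equality) auto
  then show ?thesis
    unfolding bar_prim_def using Union_tribes_in[OF T] by (simp add: image_image)
qed

end

section \<open>The zero tribe\<close>

text \<open>One construction for both single-element operations: \<open>r\<close> is the row of the
  new element against the old ones, its column is then forced by skew-symmetry, and the diagonal
  entry is neutral.\<close>

definition extend_row ::
    "('h, 'm) monoid_scheme \<Rightarrow> ('a, 'h) bmatrix \<Rightarrow> 'a \<Rightarrow> ('a \<Rightarrow> 'h) \<Rightarrow> ('a, 'h) bmatrix" where
  "extend_row H T g r = \<lparr>elems = insert g (elems T), base = base T,
     form = (\<lambda>(x, y)\<in>insert g (elems T) \<times> insert g (elems T).
       if x = g then (if y = g then \<one>\<^bsub>H\<^esub> else r y)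
       else if y = g then inv\<^bsub>H\<^esub> r x else form T (x, y))\<rparr>"

lemma extends_byD:
  assumes "extends_by H T S T'"
  shows "based_matrix H T" "based_matrix H T'" "elems T \<inter> S = {}" "elems T' = elems T \<union> S"
    "base T' = base T" "\<And>g h. g \<in> elems T \<Longrightarrow> h \<in> elems T \<Longrightarrow> form T' (g, h) = form T (g, h)"
  using assms by (simp_all add: extends_by_def)

context based_matrices
begin

lemma extends_by_extend_row:
  assumes T: "based_matrix H T" and g: "g \<notin> elems T" and r: "r \<in> elems T \<rightarrow> carrier H"
    and rs: "r (base T) = \<one>"
  shows "extends_by H T {g} (extend_row H T g r)"
proof -
  let ?T = "extend_row H T g r"
  have s: "base T \<in> elems T" "base T \<noteq> g" using based_matrixD(2)[OF T] g by auto
  have f: "form ?T (x, y) = (if x = g then (if y = g then \<one> else r y)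
       else if y = g then inv r x else form T (x, y))"
    if "x \<in> insert g (elems T)" "y \<in> insert g (elems T)" for x y
    using that unfolding extend_row_def by auto
  have "based_matrix H ?T"
    unfolding based_matrix_def
  proof (intro conjI ballI)
    show "form ?T \<in> elems ?T \<times> elems ?T \<rightarrow>\<^sub>E carrier H"
      using funcset_mem[OF r] inv_closed[OF funcset_mem[OF r]] form_closed[OF T]
      by (auto simp: extend_row_def)
    fix x y assume xy: "x \<in> elems ?T" "y \<in> elems ?T"
    have e: "z \<in> elems ?T \<Longrightarrow> z \<noteq> g \<Longrightarrow> z \<in> elems T" for z by (simp add: extend_row_def)
    have i: "x \<in> insert g (elems T)" "y \<in> insert g (elems T)"
      using xy by (simp_all add: extend_row_def)
    show "form ?T (y, x) = inv form ?T (x, y)"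
    proof (cases "x = g"; cases "y = g")
      assume "x \<noteq> g" "y \<noteq> g"
      then show ?thesis
        unfolding f[OF i] f[OF i(2,1)] using based_matrix_skew[OF T e[OF xy(1)] e[OF xy(2)]] by simp
    next
      assume "x \<noteq> g" "y = g"
      then show ?thesis
        unfolding f[OF i] f[OF i(2,1)] using inv_inv[OF funcset_mem[OF r e[OF xy(1)]]] by simp
    next
      assume "x = g" "y = g"
      then show ?thesis unfolding f[OF i] f[OF i(2,1)] by simp
    next
      assume "x = g" "y \<noteq> g"
      then show ?thesis unfolding f[OF i] f[OF i(2,1)] by simp
    qed
  qed (use s based_matrixD[OF T] in \<open>simp_all add: extend_row_def\<close>)
  then show ?thesis
    unfolding extends_by_def using T g by (auto simp: f) (simp_all add: extend_row_def)
qed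

lemma annihilating_extension:
  assumes T: "based_matrix H T" and g: "g \<notin> elems T"
  shows "\<exists>T'. extends_by H T {g} T' \<and> annihilating H T' g"
proof -
  let ?T = "extend_row H T g (\<lambda>_. \<one>)"
  have "extends_by H T {g} ?T"
    by (rule extends_by_extend_row[OF T g]) auto
  moreover have "annihilating H ?T g"
    using g based_matrixD(2)[OF T] by (auto simp: annihilating_def nonbase_def extend_row_def)
  ultimately show ?thesis by blast
qed

lemma core_extension:
  assumes T: "based_matrix H T" and g: "g \<notin> elems T"
  shows "\<exists>T'. extends_by H T {g} T' \<and> core T' g"
proof -
  let ?T = "extend_row H T g (\<lambda>y. form T (base T, y))"
  have s: "base T \<in> elems T" "base T \<noteq> g" using based_matrixD(2)[OF T] g by auto
  have "extends_by H T {g} ?T"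
    by (rule extends_by_extend_row[OF T g]) (use form_closed[OF T s(1)] based_matrixD(4)[OF T] in auto)
  \<comment> \<open>In the new column both rows are neutral: that of \<open>g\<close> by the choice
    of the diagonal entry, that of the base because b(s,s) = 0.\<close>
  moreover have "core ?T g"
    using s based_matrixD(4)[OF T] by (auto simp: core_def nonbase_def extend_row_def)
  ultimately show ?thesis by blast
qed

lemma annihilating_extends:
  assumes ext: "extends_by H T S T'" and g: "annihilating H T g"
    and S: "\<And>k. k \<in> S \<Longrightarrow> form T' (k, g) = \<one>"
  shows "annihilating H T' g"
proof -
  note e = extends_byD[OF ext]
  have gT: "g \<in> elems T" "g \<noteq> base T" using g by (auto simp: annihilating_def nonbase_def)
  have "form T' (g, h) = \<one>" if "h \<in> elems T'" for h
  proof (cases "h \<in> elems T")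
    case True
    then show ?thesis using e(6)[OF gT(1)] g by (simp add: annihilating_def)
  next
    case False
    then have "h \<in> S" using that e(4) by simp
    then have "form T' (h, g) = \<one>" by (rule S)
    then show ?thesis
      using based_matrix_skew[OF e(2) that, of g] gT e(4) by simp
  qed
  then show ?thesis
    using gT e(4,5) by (simp add: annihilating_def nonbase_def)
qed

lemma annihilating_column:
  assumes "based_matrix H T" "annihilating H T g" "h \<in> elems T"
  shows "form T (h, g) = \<one>"
  using based_matrix_skew[OF assms(1) _ assms(3), of g] assms(2,3)
  by (simp add: annihilating_def nonbase_def)

text \<open>Only one column is new, and all its entries are neutral, so each defining equation holds
  there trivially. Hence deleting a set commutes with adjoining an annihilating element
  (\<open>zero_tribe_oper\<close>).\<close>

lemma deletable_annihilating_extension: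
  assumes ext: "extends_by H T {g} T'" and g: "annihilating H T' g" and S: "deletable H T S"
  shows "deletable H T' S"
proof -
  note e = extends_byD[OF ext]
  have col: "form T' (h, g) = \<one>" if "h \<in> elems T'" for h
    using annihilating_column[OF e(2) g that] .
  have s: "base T \<in> elems T" using based_matrixD(2)[OF e(1)] .
  have nb: "k \<in> nonbase T' \<and> k \<in> elems T" if "k \<in> nonbase T" for k
    using that e by (auto simp: nonbase_def)
  have g1: "form T' (k, g) = \<one>" if "k \<in> elems T" for k
    using col that e(4) by simp
  consider k where "S = {k}" "annihilating H T k" | k where "S = {k}" "core T k"
    | k k' where "k \<noteq> k'" "S = {k, k'}" "complementary H T k k'"
    using S by (auto simp: deletable_def)
  then show ?thesis
  proof cases
    case 1
    have "annihilating H T' k"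
      using annihilating_extends[OF ext 1(2)] g 1(2) e(4)
      by (auto simp: annihilating_def nonbase_def)
    with 1 show ?thesis by (auto simp: deletable_def)
  next
    case 2
    then have "core T' k"
      using nb[of k] e(4,5,6) s g1 unfolding core_def by auto
    with 2 show ?thesis by (auto simp: deletable_def)
  next
    case 3
    then have "complementary H T' k k'"
      using nb[of k] nb[of k'] e(4,5,6) s g1 unfolding complementary_def by auto
    with 3 show ?thesis by (auto simp: deletable_def)
  qed
qed

lemma core_annihilating_extension:
  assumes ext: "extends_by H T {g} T'" and g: "annihilating H T' g" and k: "core T k"
  shows "core T' k"
proof -
  note e = extends_byD[OF ext]
  have col: "form T' (h, g) = \<one>" if "h \<in> elems T'" for h
    using annihilating_column[OF e(2) g that] .
  have "base T \<in> elems T" using based_matrixD(2)[OF e(1)] .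
  then show ?thesis
    using k e(4,5,6) col unfolding core_def nonbase_def by auto
qed

end

context tribal_matrices
begin

lemma fresh_element: "finite X \<Longrightarrow> \<exists>g :: 'a. g \<notin> X"
  using infinite_elements ex_new_if_finite by blast

text \<open>After a core element is adjoined, it is complementary to every annihilating element.\<close>

lemma annihilating_same:
  assumes T: "T \<in> family" and g: "annihilating H T g" "annihilating H T g'"
  shows "same T g g'"
proof -
  have bT: "based_matrix H T" using family_based[OF T] .
  obtain k where "k \<notin> elems T" using fresh_element[OF based_matrixD(1)[OF bT]] by blast
  then obtain T' where ext: "extends_by H T {k} T'" and k: "core T' k"
    using core_extension[OF bT] by blast
  have op: "oper H T T'" using ext k by (auto simp: oper_def op_M2_def)
  have T': "T' \<in> family" using family_oper[OF op] T by simp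
  note e = extends_byD[OF ext]
  \<comment> \<open>The new row repeats that of the base, which is neutral at an annihilating
    element.\<close>
  have ann: "annihilating H T' x" if x: "annihilating H T x" for x
  proof (rule annihilating_extends[OF ext x])
    fix j assume "j \<in> {k}"
    have xT: "x \<in> elems T" using x by (simp add: annihilating_def nonbase_def)
    then have "form T' (k, x) = form T' (base T', x)"
      using k e(4) by (simp add: core_def)
    also have "\<dots> = form T (base T, x)"
      using e(5) e(6)[OF based_matrixD(2)[OF bT] xT] by simp
    also have "\<dots> = \<one>" using annihilating_column[OF bT x based_matrixD(2)[OF bT]] .
    finally show "form T' (j, x) = \<one>" using \<open>j \<in> {k}\<close> by simp
  qed
  have "same T' x k" if "annihilating H T x" for x
    using same_complementary[OF T'] annihilating_core_complementary[OF e(2) ann[OF that] k] by blast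
  then have "same T' g g'"
    using same_trans[OF T'] same_sym g by blast
  then show ?thesis
    using same_oper[OF op T'] g by (simp add: annihilating_def nonbase_def)
qed

definition zero_extension :: "('a, 'h) bmatrix \<Rightarrow> 'a \<Rightarrow> ('a, 'h) bmatrix \<Rightarrow> bool" where
  "zero_extension T g T' \<longleftrightarrow> extends_by H T {g} T' \<and> annihilating H T' g"

lemma zero_extension_oper: "zero_extension T g T' \<Longrightarrow> oper H T T'"
  by (auto simp: zero_extension_def oper_def op_M1_def)

lemma zero_extension_exists:
  assumes "T \<in> family" "finite X"
  shows "\<exists>g T'. g \<notin> X \<and> zero_extension T g T'"
proof -
  have bT: "based_matrix H T" using family_based[OF assms(1)] .
  obtain g where "g \<notin> X \<union> elems T"
    using fresh_element[of "X \<union> elems T"] assms(2) based_matrixD(1)[OF bT] by blast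
  then show ?thesis
    using annihilating_extension[OF bT, of g] by (auto simp: zero_extension_def)
qed

text \<open>Since the new elements differ, both can be adjoined at once. The result is an M_1
  extension of \<open>T1\<close> by \<open>g2\<close> and of \<open>T2\<close> by \<open>g1\<close>,
  and in it \<open>g1\<close> and \<open>g2\<close> are annihilating, hence in one tribe.\<close>

lemma zero_extension_distinct:
  assumes T: "T \<in> family" and z1: "zero_extension T g1 T1" and z2: "zero_extension T g2 T2"
    and ne: "g1 \<noteq> g2" and x: "x \<in> elems T"
  shows "same T1 x g1 \<longleftrightarrow> same T2 x g2"
proof -
  note e1 = extends_byD[OF z1[unfolded zero_extension_def, THEN conjunct1]]
    and e2 = extends_byD[OF z2[unfolded zero_extension_def, THEN conjunct1]]
  have a1: "annihilating H T1 g1" and a2: "annihilating H T2 g2"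
    using z1 z2 by (simp_all add: zero_extension_def)
  have "g2 \<notin> elems T1" using e1(4) e2(3) ne by auto
  then obtain T12 where T12: "extends_by H T1 {g2} T12" "annihilating H T12 g2"
    using annihilating_extension[OF e1(2)] by blast
  note e = extends_byD[OF T12(1)]
  have op1: "oper H T1 T12" using T12 by (auto simp: oper_def op_M1_def)
  have T1: "T1 \<in> family" using family_oper[OF zero_extension_oper[OF z1]] T by simp
  have T12f: "T12 \<in> family" using family_oper[OF op1] T1 by simp
  have a1': "annihilating H T12 g1"
    using annihilating_extends[OF T12(1) a1] T12(2) e(4) e1(4) by (simp add: annihilating_def)
  have "form T12 (u, v) = form T2 (u, v)" if uv: "u \<in> elems T2" "v \<in> elems T2" for u v
  proof -
    have uv': "u \<in> elems T12" "v \<in> elems T12" using uv e(4) e1(4) e2(4) by auto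
    consider "u = g2" | "v = g2" | "u \<in> elems T" "v \<in> elems T" using uv e2(4) by auto
    then show ?thesis
    proof cases
      case 1
      then show ?thesis using a2 T12(2) uv uv' by (simp add: annihilating_def)
    next
      case 2
      then show ?thesis
        using annihilating_column[OF e2(2) a2 uv(1)] annihilating_column[OF e(2) T12(2) uv'(1)] by simp
    next
      case 3
      then show ?thesis using e(6) e1(4,6) e2(6) by simp
    qed
  qed
  then have "extends_by H T2 {g1} T12"
    unfolding extends_by_def using e2 e1 e ne by auto
  then have op2: "oper H T2 T12" using a1' by (auto simp: oper_def op_M1_def)
  have "same T1 x g1 \<longleftrightarrow> same T12 x g1"
    using same_oper[OF op1 T12f] x e1(4) by simp
  also have "\<dots> \<longleftrightarrow> same T12 x g2"
    using annihilating_same[OF T12f a1' T12(2)] same_trans[OF T12f] same_sym by blast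
  also have "\<dots> \<longleftrightarrow> same T2 x g2"
    using same_oper[OF op2 T12f] x e2(4) by simp
  finally show ?thesis .
qed

text \<open>A third fresh element, compared with each of the two, also covers the case
  \<open>g1 = g2\<close>.\<close>

lemma zero_extension_independent:
  assumes T: "T \<in> family" and z: "zero_extension T g1 T1" "zero_extension T g2 T2"
    and x: "x \<in> elems T"
  shows "same T1 x g1 \<longleftrightarrow> same T2 x g2"
proof -
  obtain g T' where g: "g \<notin> {g1, g2}" "zero_extension T g T'"
    using zero_extension_exists[OF T, of "{g1, g2}"] by blast
  then show ?thesis
    using zero_extension_distinct[OF T z(1) g(2) _ x] zero_extension_distinct[OF T z(2) g(2) _ x] by auto
qed

lemma zero_tribe_eq:
  assumes T: "T \<in> family" and z: "zero_extension T g T'"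
  shows "zero_tribe H \<CC> T = {x \<in> elems T. same T' x g}"
proof -
  have cl: "C' \<inter> elems T = {x \<in> elems T. same T' x g}"
    if U: "extends_by H T {k} U" "annihilating H U k" and C: "C' \<in> \<CC> U" "k \<in> C'" for k U C'
  proof -
    have zU: "zero_extension T k U" using U by (simp add: zero_extension_def)
    then have "U \<in> family" using family_oper[OF zero_extension_oper] T by blast
    then have "C' = {y. same U k y}" using tribe_eq_same C by blast
    then show ?thesis
      using zero_extension_independent[OF T zU z] same_sym by blast
  qed
  have T': "T' \<in> family" using family_oper[OF zero_extension_oper[OF z]] T by simp
  have g: "g \<in> elems T'" using z by (auto simp: zero_extension_def annihilating_def nonbase_def)
  show ?thesis
    unfolding zero_tribe_def
  proof (rule the_equality)
    show "\<exists>k U C'. extends_by H T {k} U \<and> annihilating H U k \<and> C' \<in> \<CC> U \<and> k \<in> C' \<and>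
        {x \<in> elems T. same T' x g} = C' \<inter> elems T"
      using z cl[of g T'] tribe_of[OF T' g] same_refl[OF T' g]
      unfolding zero_extension_def by blast
  qed (use cl in blast)
qed

text \<open>The zero tribe may be empty, but as soon as it has an element it is a full tribe of
  \<open>T\<close>: it is the trace of a tribe of the extension.\<close>

lemma zero_tribe_same:
  assumes T: "T \<in> family" and y: "y \<in> zero_tribe H \<CC> T"
  shows "zero_tribe H \<CC> T = {x. same T y x}"
proof -
  obtain g T' where z: "zero_extension T g T'" using zero_extension_exists[OF T, of "{}"] by blast
  have op: "oper H T T'" using zero_extension_oper[OF z] .
  have T': "T' \<in> family" using family_oper[OF op] T by simp
  have y: "y \<in> elems T" "same T' y g" using y zero_tribe_eq[OF T z] by auto
  have "same T' x g \<longleftrightarrow> same T y x" if "x \<in> elems T" for x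
    using same_oper[OF op T' y(1) that] same_trans[OF T'] y(2) same_sym by blast
  then show ?thesis
    unfolding zero_tribe_eq[OF T z] using same_elems[OF T] by blast
qed

text \<open>In the extension, \<open>k\<close> is annihilating like the adjoined \<open>g\<close> or
  else complementary to it; both put them into one tribe.\<close>

lemma zero_tribe_annihilating_core:
  assumes T: "T \<in> family" and k: "annihilating H T k \<or> core T k"
  shows "k \<in> zero_tribe H \<CC> T"
proof -
  obtain g T' where z: "zero_extension T g T'" using zero_extension_exists[OF T, of "{}"] by blast
  have T': "T' \<in> family" using family_oper[OF zero_extension_oper[OF z]] T by simp
  have ext: "extends_by H T {g} T'" and g: "annihilating H T' g"
    using z by (simp_all add: zero_extension_def)
  note e = extends_byD[OF ext]
  have kT: "k \<in> elems T" using k by (auto simp: annihilating_def core_def nonbase_def)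
  have "same T' k g"
    using k
  proof
    assume "annihilating H T k"
    then have "annihilating H T' k"
      using annihilating_extends[OF ext] g e(4) kT by (simp add: annihilating_def)
    then show ?thesis using annihilating_same[OF T'] g by blast
  next
    assume "core T k"
    then have "core T' k" using core_annihilating_extension[OF ext g] by blast
    then show ?thesis
      using same_complementary[OF T'] annihilating_core_complementary[OF e(2) g] same_sym by blast
  qed
  then show ?thesis using zero_tribe_eq[OF T z] kT by blast
qed

text \<open>A commuting square: adjoin \<open>g\<close> to \<open>T\<close> and then delete
  \<open>S\<close>. The outcome \<open>U'\<close> is an annihilating extension of \<open>U\<close>
  by the same \<open>g\<close>, so both zero tribes are traces of one tribe of
  \<open>T'\<close>.\<close>

lemma zero_tribe_oper:
  assumes UT: "oper H U T" and T: "T \<in> family"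
  shows "zero_tribe H \<CC> U = zero_tribe H \<CC> T \<inter> elems U"
proof -
  have U: "U \<in> family" using family_oper[OF UT] T by simp
  obtain g T' where z: "zero_extension T g T'" using zero_extension_exists[OF T, of "{}"] by blast
  have T': "T' \<in> family" using family_oper[OF zero_extension_oper[OF z]] T by simp
  have ext: "extends_by H T {g} T'" and g: "annihilating H T' g"
    using z by (simp_all add: zero_extension_def)
  note e = extends_byD[OF ext] and pU = oper_psubset[OF UT]
  obtain S where S: "deletable H T S" "U = submatrix T (elems T - S)"
    using UT by (auto simp: oper_iff_deletable)
  have ST: "S \<subseteq> elems T" using deletable_nonbase[OF S(1)] by (auto simp: nonbase_def)
  define U' where "U' = submatrix T' (elems T' - S)"
  have op: "oper H U' T'"
    using deletable_annihilating_extension[OF ext g S(1)] e(2) by (auto simp: U'_def oper_iff_deletable)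
  have eU': "elems U' = elems U \<union> {g}" "g \<notin> elems U"
    using S(2) e(3,4) ST by (auto simp: U'_def)
  have "form U' (x, y) = form U (x, y)" if "x \<in> elems U" "y \<in> elems U" for x y
    using that S(2) e(4,6) by (simp add: U'_def)
  then have "extends_by H U {g} U'"
    unfolding extends_by_def using oper_based(1)[OF UT] oper_based(1)[OF op] eU'
      oper_psubset(2)[OF op] pU(2) e(5) by simp
  moreover have "annihilating H U' g"
    using g eU'(1) oper_psubset(2)[OF op] oper_psubset(1)[OF op] oper_form[OF op]
    by (auto simp: annihilating_def nonbase_def)
  ultimately have zU: "zero_extension U g U'" by (simp add: zero_extension_def)
  have "same U' x g \<longleftrightarrow> same T' x g" if "x \<in> elems U" for x
    using same_oper[OF op T'] that eU' by simp
  then show ?thesis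
    unfolding zero_tribe_eq[OF U zU] zero_tribe_eq[OF T z] using pU(1) by blast
qed

end

section \<open>Classes that avoid the zero tribe\<close>

context primitive_representative
begin

text \<open>One index set for the formal sums of every \<open>T\<close>: it is fixed at
  \<open>P\<close>, and \<open>zero_free_iff\<close> shows that any other matrix would define the
  same blocks.\<close>

definition zero_free :: "'a set set" where
  "zero_free = {D \<in> blocks. bar_class P D \<inter> zero_tribe H \<CC> P = {}}"

lemma zero_free_subset: "zero_free \<subseteq> blocks"
  by (auto simp: zero_free_def)

text \<open>A common element of the class and the zero tribe could be lost in passing to the smaller
  matrix. Its whole tribe is common to both, however, and contains a marked point, which
  survives.\<close>

lemma zero_free_iff:
  assumes T: "T \<in> family" and D: "D \<in> blocks"
  shows "D \<in> zero_free \<longleftrightarrow> bar_class T D \<inter> zero_tribe H \<CC> T = {}"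
proof -
  have "bar_class U D \<inter> zero_tribe H \<CC> U = {} \<longleftrightarrow> bar_class V D \<inter> zero_tribe H \<CC> V = {}"
    if V: "V \<in> family" and UV: "oper H U V" for U V
  proof
    have U: "U \<in> family" using family_oper[OF UV] V by simp
    obtain \<phi> where m: "marking U \<phi>" using marking_exists[OF U] by blast
    assume *: "bar_class U D \<inter> zero_tribe H \<CC> U = {}"
    show "bar_class V D \<inter> zero_tribe H \<CC> V = {}"
    proof (rule ccontr)
      assume "bar_class V D \<inter> zero_tribe H \<CC> V \<noteq> {}"
      then obtain y where y: "y \<in> bar_class V D" "y \<in> zero_tribe H \<CC> V" by blast
      then obtain x where x: "x \<in> D" "same V y (\<phi> x)"
        using bar_class_eq[OF V marking_oper[OF UV V m] D] by blast
      have "\<phi> x \<in> zero_tribe H \<CC> V" using zero_tribe_same[OF V y(2)] x(2) by blast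
      moreover have "\<phi> x \<in> bar_class V D" using bar_class_same[OF V y(1) x(2)] .
      moreover have "\<phi> x \<in> elems U" using marking_elems[OF U m] x(1) blocks_subset[OF D] by blast
      ultimately show False
        using * bar_class_oper[OF UV V D] zero_tribe_oper[OF UV V] by blast
    qed
  next
    assume "bar_class V D \<inter> zero_tribe H \<CC> V = {}"
    then show "bar_class U D \<inter> zero_tribe H \<CC> U = {}"
      using bar_class_oper[OF UV V D] zero_tribe_oper[OF UV V] by blast
  qed
  from family_invariant[OF T P_family, of "\<lambda>U. bar_class U D \<inter> zero_tribe H \<CC> U = {}", OF this]
  show ?thesis using D by (simp add: zero_free_def)
qed

text \<open>If the zero tribe is primitive, exactly one class meets it, and that class is removed.
  Otherwise no class meets it, since a tribe meeting a class is primitive; removing the empty set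
  then changes nothing because classes are nonempty.\<close>

lemma bar_star_eq:
  assumes T: "T \<in> family"
  shows "bar_star H \<CC> P T = bar_class T ` zero_free"
proof (cases "zero_tribe H \<CC> T \<in> prim_tribes H \<CC> T")
  case True
  then obtain D where D: "D \<in> blocks" "zero_tribe H \<CC> T \<in> tribes_in T D"
    using prim_tribes_eq[OF T] by blast
  have sub: "zero_tribe H \<CC> T \<subseteq> bar_class T D" using D(2) by (simp add: tribes_in_def)
  have "zero_tribe H \<CC> T \<in> \<CC> T" using D tribes_in_iff[OF T D(1)] by blast
  then have "zero_tribe H \<CC> T \<noteq> {}"
    using tribes_partition[OF T] unfolding partition_on_def by metis
  then obtain y where y: "y \<in> zero_tribe H \<CC> T" by blast
  have uniq: "E = D" if "E \<in> blocks" "bar_class T E \<inter> zero_tribe H \<CC> T \<noteq> {}" for E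
    using bar_class_disjoint[OF T that(1) D(1)] that(2) sub by blast
  have "(THE E. E \<in> bar_prim H \<CC> P T \<and> zero_tribe H \<CC> T \<subseteq> E) = bar_class T D"
    unfolding bar_prim_eq[OF T]
  proof (rule the_equality)
    fix E assume "E \<in> bar_class T ` blocks \<and> zero_tribe H \<CC> T \<subseteq> E"
    then obtain F where "F \<in> blocks" "E = bar_class T F" "zero_tribe H \<CC> T \<subseteq> E" by blast
    then show "E = bar_class T D" using uniq[of F] y by blast
  qed (use D sub in blast)
  then have z: "zero_class H \<CC> P T = bar_class T D"
    using True by (simp add: zero_class_def prim_tribes_def)
  have "zero_free = blocks - {D}"
    using uniq sub y zero_free_iff[OF T] zero_free_subset D(1) by blast
  then show ?thesis
    unfolding bar_star_def bar_prim_eq[OF T] z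
    using inj_bar_class[OF T] D(1) by (simp add: inj_on_image_set_diff)
next
  case False
  have "zero_class H \<CC> P T = {}"
    using False by (simp add: zero_class_def prim_tribes_def)
  moreover have "{} \<notin> bar_class T ` blocks" using bar_class_nonempty[OF T] by auto
  moreover have "bar_class T D \<inter> zero_tribe H \<CC> T = {}" if D: "D \<in> blocks" for D
  proof (rule ccontr)
    assume "bar_class T D \<inter> zero_tribe H \<CC> T \<noteq> {}"
    then obtain y where y: "y \<in> bar_class T D" "y \<in> zero_tribe H \<CC> T" by blast
    then have "zero_tribe H \<CC> T \<in> \<CC> T"
      using tribe_of[OF T, of y] zero_tribe_same[OF T y(2)] bar_class_subset[OF T] by auto
    then have "zero_tribe H \<CC> T \<in> tribes_in T D"
      using tribes_in_iff[OF T D] y by blast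
    then show False using False by (simp add: tribes_in_def)
  qed
  then have "zero_free = blocks" using zero_free_iff[OF T] zero_free_subset by blast
  ultimately show ?thesis
    unfolding bar_star_def bar_prim_eq[OF T] by auto
qed

end

section \<open>The groups and the parity\<close>

lemma image_r_coset:
  assumes "h \<in> hom G G'" "N \<subseteq> carrier G" "x \<in> carrier G"
  shows "h ` (N #>\<^bsub>G\<^esub> x) = (h ` N) #>\<^bsub>G'\<^esub> h x"
proof -
  have "h (n \<otimes>\<^bsub>G\<^esub> x) = h n \<otimes>\<^bsub>G'\<^esub> h x" if "n \<in> N" for n
    using assms that by (auto simp: hom_def)
  then show ?thesis
    unfolding r_coset_def by (auto simp: image_iff)
qed

lemma iso_FactGroup_image:
  assumes G: "group G" "group G'" and h: "h \<in> iso G G'" and N: "N \<lhd> G"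
  shows "(\<lambda>K. h ` K) \<in> iso (G Mod N) (G' Mod (h ` N))"
proof -
  have hom: "h \<in> hom G G'" and inj: "inj_on h (carrier G)" and im: "h ` carrier G = carrier G'"
    using h by (auto simp: iso_def bij_betw_def)
  have sub: "N \<subseteq> carrier G"
    using N by (simp add: normal_imp_subgroup subgroup.subset)
  have coset: "h ` (N #>\<^bsub>G\<^esub> x) = (h ` N) #>\<^bsub>G'\<^esub> h x" if "x \<in> carrier G" for x
    using image_r_coset[OF hom sub that] .
  have K: "K \<subseteq> carrier G" if K: "K \<in> carrier (G Mod N)" for K
  proof -
    obtain x where "x \<in> carrier G" "K = N #>\<^bsub>G\<^esub> x"
      using K unfolding carrier_FactGroup by blast
    then show ?thesis
      using monoid.r_coset_subset_G[OF group.is_monoid[OF G(1)] sub] by simp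
  qed
  have carr: "(\<lambda>K. h ` K) ` carrier (G Mod N) = carrier (G' Mod (h ` N))"
    unfolding carrier_FactGroup im[symmetric] image_image
    using coset by (intro image_cong) auto
  have "inj_on (\<lambda>K. h ` K) (carrier (G Mod N))"
    using inj_on_image_eq_iff[OF inj] K by (intro inj_onI) blast
  moreover have "(\<lambda>K. h ` K) \<in> hom (G Mod N) (G' Mod (h ` N))"
    using carr K set_mult_hom[OF hom] by (intro homI) auto
  ultimately show ?thesis
    using carr by (simp add: iso_def bij_betw_def)
qed

section \<open>Formal sums over finite sets, and weights of rows\<close>

context based_matrices
begin

text \<open>Over a finite index set the finite-support condition of the direct sum is
  vacuous.\<close>

lemma carrier_formal_sums: "finite S \<Longrightarrow> carrier (formal_sums H S) = (S \<rightarrow>\<^sub>E carrier H)"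
  unfolding formal_sums_def by (subst carrier_sum_group) auto

lemma mult_formal_sums: "l \<otimes>\<^bsub>formal_sums H S\<^esub> m = (\<lambda>x\<in>S. l x \<otimes> m x)"
  by (simp add: formal_sums_def)

lemma one_formal_sums: "\<one>\<^bsub>formal_sums H S\<^esub> = (\<lambda>x\<in>S. \<one>)"
  by (simp add: formal_sums_def)

lemma comm_group_formal_sums: "finite S \<Longrightarrow> comm_group (formal_sums H S)"
proof (rule group.group_comm_groupI)
  show "group (formal_sums H S)"
    unfolding formal_sums_def by (rule sum_group) simp
  fix l m assume "finite S" "l \<in> carrier (formal_sums H S)" "m \<in> carrier (formal_sums H S)"
  then show "l \<otimes>\<^bsub>formal_sums H S\<^esub> m = m \<otimes>\<^bsub>formal_sums H S\<^esub> l"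
    unfolding mult_formal_sums by (intro restrict_ext) (auto simp: carrier_formal_sums PiE_iff m_comm)
qed

lemma reindex_iso:
  assumes "finite Z" "inj_on f Z"
  shows "(\<lambda>l. \<lambda>z\<in>Z. l (f z)) \<in> iso (formal_sums H (f ` Z)) (formal_sums H Z)"
proof -
  have c: "carrier (formal_sums H (f ` Z)) = (f ` Z \<rightarrow>\<^sub>E carrier H)"
    "carrier (formal_sums H Z) = (Z \<rightarrow>\<^sub>E carrier H)"
    using assms(1) by (simp_all add: carrier_formal_sums)
  have "bij_betw (\<lambda>l. \<lambda>z\<in>Z. l (f z)) (f ` Z \<rightarrow>\<^sub>E carrier H) (Z \<rightarrow>\<^sub>E carrier H)"
  proof (rule bij_betw_byWitness[where f' = "\<lambda>m. \<lambda>y\<in>f ` Z. m (inv_into Z f y)"])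
    show "\<forall>l\<in>f ` Z \<rightarrow>\<^sub>E carrier H. (\<lambda>y\<in>f ` Z. (\<lambda>z\<in>Z. l (f z)) (inv_into Z f y)) = l"
    proof
      fix l assume l: "l \<in> f ` Z \<rightarrow>\<^sub>E carrier H"
      show "(\<lambda>y\<in>f ` Z. (\<lambda>z\<in>Z. l (f z)) (inv_into Z f y)) = l"
        by (rule extensionalityI[of _ "f ` Z"]) (use l assms(2) in \<open>auto simp: PiE_iff\<close>)
    qed
    show "\<forall>m\<in>Z \<rightarrow>\<^sub>E carrier H. (\<lambda>z\<in>Z. (\<lambda>y\<in>f ` Z. m (inv_into Z f y)) (f z)) = m"
    proof
      fix m assume m: "m \<in> Z \<rightarrow>\<^sub>E carrier H"
      show "(\<lambda>z\<in>Z. (\<lambda>y\<in>f ` Z. m (inv_into Z f y)) (f z)) = m"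
        by (rule extensionalityI[of _ Z]) (use m assms(2) in \<open>auto simp: PiE_iff\<close>)
    qed
  qed (use assms(2) in \<open>auto simp: PiE_iff\<close>)
  moreover have "(\<lambda>l. \<lambda>z\<in>Z. l (f z)) \<in> hom (formal_sums H (f ` Z)) (formal_sums H Z)"
    unfolding hom_def c by (auto simp: mult_formal_sums PiE_iff intro!: restrict_ext)
  ultimately show ?thesis by (simp add: iso_def c)
qed

text \<open>The coefficient in \<open>bar_P\<close> with the row b(g, -) replaced by an arbitrary
  function: (P2) and (P3) involve sums of rows, which need not be rows of elements.\<close>

definition weight :: "('a, 'h) bmatrix \<Rightarrow> ('a \<Rightarrow> 'h) \<Rightarrow> 'a set \<Rightarrow> 'h" where
  "weight T r C = finprod H r C \<otimes> inv (r (base T) [^] (card C div 2))"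

lemma weight_closed:
  assumes "C \<subseteq> elems T" "base T \<in> elems T" "r \<in> elems T \<rightarrow> carrier H"
  shows "weight T r C \<in> carrier H"
proof -
  have "r \<in> C \<rightarrow> carrier H" "r (base T) \<in> carrier H" using assms by auto
  then show ?thesis unfolding weight_def by simp
qed

lemma weight_mult:
  assumes C: "C \<subseteq> elems T" and s: "base T \<in> elems T"
    and r: "r \<in> elems T \<rightarrow> carrier H" "r' \<in> elems T \<rightarrow> carrier H"
  shows "weight T r C \<otimes> weight T r' C = weight T (\<lambda>h. r h \<otimes> r' h) C"
proof -
  have rC: "r \<in> C \<rightarrow> carrier H" "r' \<in> C \<rightarrow> carrier H" using C r by auto
  have a: "r (base T) \<in> carrier H" "r' (base T) \<in> carrier H" using s r by auto
  let ?n = "card C div 2"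
  have "inv ((r (base T) \<otimes> r' (base T)) [^] ?n) = inv (r (base T) [^] ?n) \<otimes> inv (r' (base T) [^] ?n)"
    using a by (simp add: nat_pow_distrib inv_mult)
  then show ?thesis
    unfolding weight_def using rC a by (simp add: finprod_multf m_ac)
qed

lemma weight_cong:
  assumes "C \<subseteq> elems T" "base T \<in> elems T" "r' \<in> elems T \<rightarrow> carrier H"
    and "\<And>h. h \<in> elems T \<Longrightarrow> r h = r' h"
  shows "weight T r C = weight T r' C"
proof -
  have "finprod H r C = finprod H r' C"
    by (rule finprod_cong') (use assms in auto)
  then show ?thesis unfolding weight_def using assms by simp
qed

lemma weight_one: "weight T (\<lambda>_. \<one>) C = \<one>"
  by (simp add: weight_def)

text \<open>The floor term vanishes because b(s,s) = 0, so the weights of the row of the base are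
  the coefficients of \<open>bar_s\<close>.\<close>

lemma weight_base:
  assumes T: "based_matrix H T" and C: "C \<subseteq> elems T"
  shows "weight T (\<lambda>h. form T (base T, h)) C = form_char H T (base T) C"
proof -
  have "(\<lambda>h. form T (base T, h)) \<in> C \<rightarrow> carrier H"
    using form_closed[OF T based_matrixD(2)[OF T]] C by auto
  then show ?thesis
    unfolding weight_def form_char_def using based_matrixD(4)[OF T] by simp
qed

lemma row_closed:
  "based_matrix H T \<Longrightarrow> x \<in> elems T \<Longrightarrow> (\<lambda>h. form T (x, h)) \<in> elems T \<rightarrow> carrier H"
  using form_closed by auto

end

section \<open>Invariance of weights, and the common quotient\<close>

context primitive_representative
begin

lemma finite_zero_free: "finite zero_free"
  using finite_subset[OF zero_free_subset finite_blocks] .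

lemma bar_class_extension:
  assumes UT: "oper H U T" and T: "T \<in> family" and D: "D \<in> zero_free"
  obtains "bar_class T D = bar_class U D"
  | g g' where "g \<noteq> g'" "g \<notin> elems U" "g' \<notin> elems U" "complementary H T g g'"
      "bar_class T D = insert g (insert g' (bar_class U D))"
proof -
  have Db: "D \<in> blocks" using D zero_free_subset by blast
  have eq: "bar_class U D = bar_class T D \<inter> elems U" using bar_class_oper[OF UT T Db] .
  have sub: "bar_class T D \<subseteq> elems T" using bar_class_subset[OF T] .
  have z: "bar_class T D \<inter> zero_tribe H \<CC> T = {}" using zero_free_iff[OF T Db] D by simp
  obtain S where S: "deletable H T S" "U = submatrix T (elems T - S)"
    using UT by (auto simp: oper_iff_deletable)
  then have eU: "elems U = elems T - S" by simp
  have ST: "S \<subseteq> elems T" using deletable_nonbase[OF S(1)] by (auto simp: nonbase_def)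
  consider k where "S = {k}" "annihilating H T k \<or> core T k"
    | k k' where "k \<noteq> k'" "S = {k, k'}" "complementary H T k k'"
    using S(1) by (auto simp: deletable_def)
  then show thesis
  proof cases
    case 1
    then have "k \<notin> bar_class T D" using zero_tribe_annihilating_core[OF T 1(2)] z by blast
    then have "bar_class T D = bar_class U D" using eq eU sub 1 by blast
    then show thesis using that(1) by blast
  next
    case 2
    have s: "same T k k'" using same_complementary[OF T 2(3)] .
    show thesis
    proof (cases "k \<in> bar_class T D")
      case True
      then have "k' \<in> bar_class T D" using bar_class_same[OF T _ s] by blast
      then have "bar_class T D = insert k (insert k' (bar_class U D))"
        using eq eU sub 2(2) True by blast
      then show thesis using that(2)[OF 2(1) _ _ 2(3)] eU 2(2) by blast
    next
      case False
      then have "k' \<notin> bar_class T D" using bar_class_same[OF T _ same_sym[OF s]] by blast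
      then have "bar_class T D = bar_class U D" using eq eU sub 2(2) False by blast
      then show thesis using that(1) by blast
    qed
  qed
qed

lemma weight_oper:
  assumes UT: "oper H U T" and T: "T \<in> family" and D: "D \<in> zero_free" and x: "x \<in> elems U"
  shows "weight T (\<lambda>h. form T (x, h)) (bar_class T D) = weight U (\<lambda>h. form U (x, h)) (bar_class U D)"
proof -
  have U: "U \<in> family" using family_oper[OF UT] T by simp
  have bT: "based_matrix H T" and bU: "based_matrix H U" using family_based T U by blast+
  note o = oper_psubset[OF UT]
  have xT: "x \<in> elems T" using x o(1) by blast
  let ?C = "bar_class U D"
  have CU: "?C \<subseteq> elems U" using bar_class_subset[OF U] .
  have fin: "finite ?C" using finite_subset[OF CU based_matrixD(1)[OF bU]] .
  have row: "(\<lambda>h. form T (x, h)) \<in> ?C \<rightarrow> carrier H"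
    using form_closed[OF bT xT] CU o(1) by blast
  have fp: "finprod H (\<lambda>h. form U (x, h)) ?C = finprod H (\<lambda>h. form T (x, h)) ?C"
    by (rule finprod_cong') (use row oper_form[OF UT x] CU in auto)
  have fs: "form U (x, base U) = form T (x, base T)"
    using oper_form[OF UT x, of "base U"] based_matrixD(2)[OF bU] o(2) by simp
  have a: "form T (x, base T) \<in> carrier H" using form_closed[OF bT xT based_matrixD(2)[OF bT]] .
  show ?thesis
  proof (rule bar_class_extension[OF UT T D])
    assume "bar_class T D = ?C"
    then show ?thesis unfolding weight_def using fp fs by simp
  next
    fix g g' assume g: "g \<noteq> g'" "g \<notin> elems U" "g' \<notin> elems U" "complementary H T g g'"
      and C: "bar_class T D = insert g (insert g' ?C)"
    have gT: "g \<in> elems T" "g' \<in> elems T" using g(4) by (auto simp: complementary_def nonbase_def)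
    have gC: "g \<notin> insert g' ?C" "g' \<notin> ?C" using g CU by auto
    have fg: "form T (x, g) \<in> carrier H" "form T (x, g') \<in> carrier H" using form_closed[OF bT xT] gT by auto
    let ?p = "finprod H (\<lambda>h. form T (x, h)) ?C"
    have p: "?p \<in> carrier H" using row by simp
    \<comment> \<open>Complementarity speaks of the rows of \<open>g\<close> and \<open>g'\<close>,
      whereas the weight of \<open>x\<close> needs their columns; skew-symmetry is applied before
      and after.\<close>
    have "form T (x, g) \<otimes> form T (x, g') = inv (form T (g, x) \<otimes> form T (g', x))"
      using based_matrix_skew[OF bT gT(1) xT] based_matrix_skew[OF bT gT(2) xT]
        form_closed[OF bT gT(1) xT] form_closed[OF bT gT(2) xT] by (simp add: inv_mult)
    also have "\<dots> = inv form T (base T, x)"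
      using g(4) xT by (simp add: complementary_def)
    also have "\<dots> = form T (x, base T)"
      using based_matrix_skew[OF bT based_matrixD(2)[OF bT] xT] by simp
    finally have pair: "form T (x, g) \<otimes> form T (x, g') = form T (x, base T)" .
    have "finprod H (\<lambda>h. form T (x, h)) (bar_class T D) = form T (x, g) \<otimes> (form T (x, g') \<otimes> ?p)"
      unfolding C using gC fin fg row by simp
    also have "\<dots> = form T (x, base T) \<otimes> ?p"
      using pair fg p by (simp add: m_assoc[symmetric])
    finally have f: "finprod H (\<lambda>h. form T (x, h)) (bar_class T D) = ?p \<otimes> form T (x, base T)"
      using a p by (simp add: m_comm)
    let ?a = "form T (x, base T)" and ?n = "card ?C div 2"
    \<comment> \<open>Both elements of the pair are new, so the cardinality grows by exactly two and
      its half by one, whatever its parity.\<close>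
    have card: "card (bar_class T D) div 2 = Suc ?n"
      unfolding C using gC fin by simp
    have "weight T (\<lambda>h. form T (x, h)) (bar_class T D) = (?p \<otimes> ?a) \<otimes> inv (?a [^] ?n \<otimes> ?a)"
      unfolding weight_def f card by simp
    also have "\<dots> = (?p \<otimes> ?a) \<otimes> (inv ?a \<otimes> inv (?a [^] ?n))"
      using a by (simp add: inv_mult_group)
    also have "\<dots> = ?p \<otimes> (?a \<otimes> (inv ?a \<otimes> inv (?a [^] ?n)))"
      using a p by (simp add: m_assoc)
    also have "?a \<otimes> (inv ?a \<otimes> inv (?a [^] ?n)) = inv (?a [^] ?n)"
      using a m_assoc[of ?a "inv ?a" "inv (?a [^] ?n)"] by simp
    finally show ?thesis
      unfolding weight_def fp fs .
  qed
qed

text \<open>Rewrites a formal sum over the classes of \<open>T\<close> as one over blocks of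
  \<open>P\<close>. Composing with \<open>bar_class T\<close> reindexes without inverting that
  map.\<close>

definition pull :: "('a, 'h) bmatrix \<Rightarrow> ('a set \<Rightarrow> 'h) \<Rightarrow> 'a set \<Rightarrow> 'h" where
  "pull T l = (\<lambda>D\<in>zero_free. l (bar_class T D))"

text \<open>The coefficients of \<open>bar_s\<close> are weights of the row of the base, so
  \<open>weight_oper\<close> applies with x = s: after reindexing, every \<open>T\<close> divides
  out the same element.\<close>

lemma pull_bar_s:
  assumes T: "T \<in> family"
  shows "pull T (bar_s H \<CC> P T) = pull P (bar_s H \<CC> P P)"
proof -
  have eq: "pull U (bar_s H \<CC> P U) = (\<lambda>D\<in>zero_free. weight U (\<lambda>h. form U (base U, h)) (bar_class U D))"
    if U: "U \<in> family" for U
    unfolding pull_def bar_s_def bar_star_eq[OF U]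
    using weight_base[OF family_based[OF U] bar_class_subset[OF U]] by (intro restrict_ext) simp
  have "pull U (bar_s H \<CC> P U) = pull V (bar_s H \<CC> P V)" if V: "V \<in> family" and UV: "oper H U V" for U V
  proof -
    have U: "U \<in> family" using family_oper[OF UV] V by simp
    show ?thesis
      unfolding eq[OF U] eq[OF V]
      using weight_oper[OF UV V] oper_psubset(2)[OF UV] based_matrixD(2)[OF family_based[OF U]]
      by (intro restrict_ext) simp
  qed
  then have "pull T (bar_s H \<CC> P T) = pull P (bar_s H \<CC> P P) \<longleftrightarrow> pull P (bar_s H \<CC> P P) = pull P (bar_s H \<CC> P P)"
    by (intro family_invariant[OF T P_family]) simp
  then show ?thesis by simp
qed

abbreviation relation_subgroup :: "('a set \<Rightarrow> 'h) set" where
  "relation_subgroup \<equiv> generate (formal_sums H zero_free) {pull P (bar_s H \<CC> P P)}"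

abbreviation model :: "('a set \<Rightarrow> 'h) set monoid" where
  "model \<equiv> formal_sums H zero_free Mod relation_subgroup"

lemma bar_star_finite: "T \<in> family \<Longrightarrow> finite (bar_star H \<CC> P T)"
  using bar_star_eq finite_zero_free by simp

lemma bar_star_subset: "T \<in> family \<Longrightarrow> C \<in> bar_star H \<CC> P T \<Longrightarrow> C \<subseteq> elems T"
  using bar_class_subset by (auto simp: bar_star_eq)

lemma formal_sums_bar_star:
  "T \<in> family \<Longrightarrow> comm_group (formal_sums H (bar_star H \<CC> P T))"
  "T \<in> family \<Longrightarrow> carrier (formal_sums H (bar_star H \<CC> P T)) = (bar_star H \<CC> P T \<rightarrow>\<^sub>E carrier H)"
  using comm_group_formal_sums[OF bar_star_finite] carrier_formal_sums[OF bar_star_finite] by blast+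

lemma inj_bar_class_zero_free: "T \<in> family \<Longrightarrow> inj_on (bar_class T) zero_free"
  using inj_on_subset[OF inj_bar_class zero_free_subset] .

lemma pull_iso:
  assumes T: "T \<in> family"
  shows "pull T \<in> iso (formal_sums H (bar_star H \<CC> P T)) (formal_sums H zero_free)"
  using reindex_iso[OF finite_zero_free inj_bar_class_zero_free[OF T]]
  unfolding bar_star_eq[OF T] pull_def[abs_def] .

lemma bar_s_closed:
  assumes T: "T \<in> family"
  shows "bar_s H \<CC> P T \<in> carrier (formal_sums H (bar_star H \<CC> P T))"
proof -
  have "form_char H T (base T) C \<in> carrier H" if "C \<in> bar_star H \<CC> P T" for C
  proof -
    have "(\<lambda>h. form T (base T, h)) \<in> C \<rightarrow> carrier H"
      using row_closed[OF family_based[OF T] based_matrixD(2)[OF family_based[OF T]]]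
        bar_star_subset[OF T that] by blast
    then show ?thesis by (simp add: form_char_def)
  qed
  then show ?thesis
    unfolding formal_sums_bar_star(2)[OF T] bar_s_def by simp
qed

lemma bar_s_subgroup_normal:
  assumes T: "T \<in> family"
  shows "subgroup (bar_s_subgroup H \<CC> P T) (formal_sums H (bar_star H \<CC> P T))"
    "bar_s_subgroup H \<CC> P T \<lhd> formal_sums H (bar_star H \<CC> P T)"
proof -
  interpret F: comm_group "formal_sums H (bar_star H \<CC> P T)"
    using formal_sums_bar_star(1)[OF T] .
  show "subgroup (bar_s_subgroup H \<CC> P T) (formal_sums H (bar_star H \<CC> P T))"
    unfolding bar_s_subgroup_def using bar_s_closed[OF T] by (intro F.generate_is_subgroup) simp
  then show "bar_s_subgroup H \<CC> P T \<lhd> formal_sums H (bar_star H \<CC> P T)"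
    by (rule F.subgroup_imp_normal)
qed

lemma comm_group_bar_A: "T \<in> family \<Longrightarrow> comm_group (bar_A H \<CC> P T)"
  unfolding bar_A_def
  using comm_group.abelian_FactGroup[OF formal_sums_bar_star(1) bar_s_subgroup_normal(1)] .

lemma pull_subgroup:
  assumes T: "T \<in> family"
  shows "pull T ` bar_s_subgroup H \<CC> P T = relation_subgroup"
proof -
  have "group_hom (formal_sums H (bar_star H \<CC> P T)) (formal_sums H zero_free) (pull T)"
    using formal_sums_bar_star(1)[OF T] comm_group_formal_sums[OF finite_zero_free] pull_iso[OF T]
    by (simp add: group_hom_def group_hom_axioms_def comm_group.axioms(2) iso_def)
  from group_hom.generate_img[OF this, of "{bar_s H \<CC> P T}"] show ?thesis
    using bar_s_closed[OF T] pull_bar_s[OF T] by (simp add: bar_s_subgroup_def)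
qed

lemma compare_iso:
  assumes T: "T \<in> family"
  shows "(\<lambda>K. pull T ` K) \<in> iso (bar_A H \<CC> P T) model"
  using iso_FactGroup_image[OF _ _ pull_iso[OF T] bar_s_subgroup_normal(2)[OF T]]
    formal_sums_bar_star(1)[OF T] comm_group_formal_sums[OF finite_zero_free]
  unfolding bar_A_def pull_subgroup[OF T] by (simp add: comm_group.axioms(2))

lemma compare_inj:
  "T \<in> family \<Longrightarrow> K \<in> carrier (bar_A H \<CC> P T) \<Longrightarrow> L \<in> carrier (bar_A H \<CC> P T) \<Longrightarrow>
    pull T ` K = pull T ` L \<Longrightarrow> K = L"
  using compare_iso[of T] unfolding iso_def bij_betw_def inj_on_def by blast

lemma compare_closed: "T \<in> family \<Longrightarrow> K \<in> carrier (bar_A H \<CC> P T) \<Longrightarrow> pull T ` K \<in> carrier model"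
  using compare_iso[of T] unfolding iso_def bij_betw_def by blast

lemma compare_surj:
  assumes "T \<in> family" "M \<in> carrier model"
  obtains K where "K \<in> carrier (bar_A H \<CC> P T)" "pull T ` K = M"
proof -
  have "M \<in> (\<lambda>K. pull T ` K) ` carrier (bar_A H \<CC> P T)"
    using compare_iso[OF assms(1)] assms(2) by (simp add: iso_def bij_betw_def)
  then show thesis using that by (elim imageE) simp
qed

lemma bar_proj_closed:
  "l \<in> carrier (formal_sums H (bar_star H \<CC> P T)) \<Longrightarrow> bar_proj H \<CC> P T l \<in> carrier (bar_A H \<CC> P T)"
  unfolding bar_proj_def bar_A_def carrier_FactGroup by blast

lemma compare_bar_proj:
  assumes T: "T \<in> family" and l: "l \<in> carrier (formal_sums H (bar_star H \<CC> P T))"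
  shows "pull T ` bar_proj H \<CC> P T l = relation_subgroup #>\<^bsub>formal_sums H zero_free\<^esub> pull T l"
  unfolding bar_proj_def pull_subgroup[OF T, symmetric]
  using pull_iso[OF T] subgroup.subset[OF bar_s_subgroup_normal(1)[OF T]] l
  by (intro image_r_coset) (auto simp: iso_def)

lemma bar_proj_mem:
  assumes T: "T \<in> family" and K: "K \<in> carrier (bar_A H \<CC> P T)" and l: "l \<in> K"
  shows "l \<in> carrier (formal_sums H (bar_star H \<CC> P T))" "bar_proj H \<CC> P T l = K"
proof -
  interpret F: comm_group "formal_sums H (bar_star H \<CC> P T)"
    using formal_sums_bar_star(1)[OF T] .
  obtain x where x: "x \<in> carrier (formal_sums H (bar_star H \<CC> P T))" "K = bar_proj H \<CC> P T x"
    using K unfolding bar_A_def carrier_FactGroup bar_proj_def by blast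
  note N = bar_s_subgroup_normal(1)[OF T]
  show "l \<in> carrier (formal_sums H (bar_star H \<CC> P T))"
    using F.r_coset_subset_G[OF subgroup.subset[OF N] x(1)] l x(2) unfolding bar_proj_def by blast
  show "bar_proj H \<CC> P T l = K"
    using F.repr_independence[OF _ x(1) N] l x(2) unfolding bar_proj_def by simp
qed

lemma class_map_eq:
  assumes UT: "oper H U T" and T: "T \<in> family" and D: "D \<in> zero_free"
  shows "class_map H \<CC> P U T (bar_class U D) = bar_class T D"
proof -
  have U: "U \<in> family" using family_oper[OF UT] T by simp
  have eq: "bar_class U E = bar_class T E \<inter> elems U" if "E \<in> zero_free" for E
    using bar_class_oper[OF UT T] that zero_free_subset by blast
  show ?thesis
    unfolding class_map_def bar_star_eq[OF T]
  proof (rule the_equality)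
    fix C assume "C \<in> bar_class T ` zero_free \<and> C \<inter> elems U = bar_class U D"
    then obtain E where E: "E \<in> zero_free" "C = bar_class T E" "bar_class U E = bar_class U D"
      using eq by auto
    then have "E = D" using inj_onD[OF inj_bar_class_zero_free[OF U] E(3,1) D] by simp
    then show "C = bar_class T D" using E by simp
  qed (use D eq in auto)
qed

text \<open>The fibre of \<open>class_map\<close> over each class is a single class, so every
  product in \<open>push\<close> has one factor, and in terms of blocks the coefficients stay the
  same.\<close>

lemma pull_push:
  assumes UT: "oper H U T" and T: "T \<in> family"
    and l: "l \<in> carrier (formal_sums H (bar_star H \<CC> P U))"
  defines "m \<equiv> push H (bar_star H \<CC> P U) (bar_star H \<CC> P T) (class_map H \<CC> P U T) l"
  shows "m \<in> carrier (formal_sums H (bar_star H \<CC> P T))" "pull T m = pull U l"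
proof -
  have U: "U \<in> family" using family_oper[OF UT] T by simp
  have lD: "l (bar_class U D) \<in> carrier H" if "D \<in> zero_free" for D
  proof -
    have "l \<in> bar_star H \<CC> P U \<rightarrow>\<^sub>E carrier H"
      using l formal_sums_bar_star(2)[OF U] by simp
    moreover have "bar_class U D \<in> bar_star H \<CC> P U"
      using that by (simp add: bar_star_eq[OF U])
    ultimately show ?thesis by (rule PiE_mem)
  qed
  have mD: "m (bar_class T D) = l (bar_class U D)" if D: "D \<in> zero_free" for D
  proof -
    have "{C \<in> bar_star H \<CC> P U. class_map H \<CC> P U T C = bar_class T D} = {bar_class U D}"
    proof (intro equalityI subsetI)
      fix C assume "C \<in> {C \<in> bar_star H \<CC> P U. class_map H \<CC> P U T C = bar_class T D}"
      then obtain E where E: "E \<in> zero_free" "C = bar_class U E" "class_map H \<CC> P U T C = bar_class T D"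
        by (auto simp: bar_star_eq[OF U])
      then have "E = D"
        using class_map_eq[OF UT T E(1)] inj_onD[OF inj_bar_class_zero_free[OF T] _ E(1) D] by simp
      then show "C \<in> {bar_class U D}" using E by simp
    qed (use class_map_eq[OF UT T D] D in \<open>simp add: bar_star_eq[OF U]\<close>)
    then show ?thesis
      using lD[OF D] D by (simp add: m_def push_def bar_star_eq[OF T])
  qed
  have "m C \<in> carrier H" if "C \<in> bar_star H \<CC> P T" for C
    using that mD lD unfolding bar_star_eq[OF T] by auto
  moreover have "m C = undefined" if "C \<notin> bar_star H \<CC> P T" for C
    using that by (simp add: m_def push_def)
  ultimately show "m \<in> carrier (formal_sums H (bar_star H \<CC> P T))"
    unfolding formal_sums_bar_star(2)[OF T] by (intro PiE_I)
  show "pull T m = pull U l"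
    unfolding pull_def using mD by (intro restrict_ext) simp
qed

text \<open>
  Taking images under \<open>pull T\<close> and \<open>pull U\<close> identifies both groups with \<open>model\<close>; under these
  identifications every operation becomes the identity.
\<close>

lemma bar_A_oper_compare:
  assumes UT: "oper H U T" and T: "T \<in> family" and K: "K \<in> carrier (bar_A H \<CC> P U)"
  shows "bar_A_oper H \<CC> P U T K \<in> carrier (bar_A H \<CC> P T) \<and> pull T ` bar_A_oper H \<CC> P U T K = pull U ` K"
proof -
  have U: "U \<in> family" using family_oper[OF UT] T by simp
  let ?f = "\<lambda>l. bar_proj H \<CC> P T
    (push H (bar_star H \<CC> P U) (bar_star H \<CC> P T) (class_map H \<CC> P U T) l)"
  \<comment> \<open>The only possible value: the coset for \<open>T\<close> with the same image in
    \<open>model\<close> as \<open>K\<close>. Each representative of \<open>K\<close> is then shown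
    to land in it.\<close>
  obtain L where L: "L \<in> carrier (bar_A H \<CC> P T)" "pull T ` L = pull U ` K"
    using compare_surj[OF T compare_closed[OF U K]] .
  have f: "?f l = L" if l: "l \<in> K" for l
  proof -
    note lc = bar_proj_mem[OF U K l]
    note p = pull_push[OF UT T lc(1)]
    have "pull T ` ?f l = pull U ` bar_proj H \<CC> P U l"
      using compare_bar_proj[OF T p(1)] compare_bar_proj[OF U lc(1)] p(2) by simp
    then show ?thesis
      using compare_inj[OF T bar_proj_closed[OF p(1)] L(1)] L(2) lc(2) by simp
  qed
  interpret F: comm_group "formal_sums H (bar_star H \<CC> P U)"
    using formal_sums_bar_star(1)[OF U] .
  obtain x where "x \<in> carrier (formal_sums H (bar_star H \<CC> P U))" "K = bar_s_subgroup H \<CC> P U #>\<^bsub>formal_sums H (bar_star H \<CC> P U)\<^esub> x"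
    using K unfolding bar_A_def carrier_FactGroup by blast
  then have "K \<noteq> {}" using F.rcos_self[OF _ bar_s_subgroup_normal(1)[OF U]] by blast
  then have "?f ` K = {L}" using f by auto
  then have "bar_A_oper H \<CC> P U T K = L" by (simp add: bar_A_oper_def)
  then show ?thesis using L by simp
qed

text \<open>For an inverse operation the preimage of \<open>K\<close> is the coset with the same
  image in \<open>model\<close>. The operation preserves these images, which makes it injective on
  the carrier, so \<open>inv_into\<close> returns that coset.\<close>

lemma bar_A_step_compare:
  assumes UV: "oper H U V \<or> oper H V U" and U: "U \<in> family" and K: "K \<in> carrier (bar_A H \<CC> P U)"
  shows "bar_A_step H \<CC> P U V K \<in> carrier (bar_A H \<CC> P V) \<and> pull V ` bar_A_step H \<CC> P U V K = pull U ` K"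
proof (cases "oper H U V")
  case True
  then have "V \<in> family" using family_oper U by blast
  then show ?thesis using bar_A_oper_compare[OF True _ K] True by (simp add: bar_A_step_def)
next
  case False
  with UV have VU: "oper H V U" by simp
  then have V: "V \<in> family" using family_oper U by blast
  note c = bar_A_oper_compare[OF VU U]
  obtain L where L: "L \<in> carrier (bar_A H \<CC> P V)" "pull V ` L = pull U ` K"
    using compare_surj[OF V compare_closed[OF U K]] .
  have "bar_A_oper H \<CC> P V U L = K"
    using compare_inj[OF U _ K] c[OF L(1)] L(2) by simp
  moreover have "inj_on (bar_A_oper H \<CC> P V U) (carrier (bar_A H \<CC> P V))"
    using c compare_inj[OF V] by (intro inj_onI) metis
  ultimately have "inv_into (carrier (bar_A H \<CC> P V)) (bar_A_oper H \<CC> P V U) K = L"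
    using L(1) by (intro inv_into_f_eq)
  then show ?thesis using False L by (simp add: bar_A_step_def)
qed

text \<open>The chain map is the comparison of \<open>T\<close> with \<open>model\<close> followed
  by the inverse comparison for \<open>P\<close>. The chain does not occur in this description, so
  both the isomorphism and its uniqueness follow.\<close>

lemma bar_A_chain_compare:
  assumes "chain H T Ts P" "K \<in> carrier (bar_A H \<CC> P T)"
  shows "bar_A_chain H \<CC> P Ts K \<in> carrier (bar_A H \<CC> P P) \<and> pull P ` bar_A_chain H \<CC> P Ts K = pull T ` K"
  using assms
proof (induction Ts arbitrary: T K)
  case (Cons U Ts)
  show ?case
  proof (cases Ts)
    case Nil
    with Cons.prems show ?thesis by (auto simp: chain_single)
  next
    case (Cons V Vs)
    with Cons.prems have V: "chain H V (V # Vs) P" "oper H T V \<or> oper H V T" "U = T"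
      by (auto simp: chain_Cons_Cons)
    have T: "T \<in> family" using chain_family_iff[OF Cons.prems(1)] P_family by simp
    note s = bar_A_step_compare[OF V(2) T Cons.prems(2)]
    show ?thesis
      using Cons.IH[of V "bar_A_step H \<CC> P T V K"] V s Cons by simp
  qed
qed (simp add: chain_def)

lemma bar_A_chain_iso:
  assumes ch: "chain H T Ts P"
  shows "bar_A_chain H \<CC> P Ts \<in> iso (bar_A H \<CC> P T) (bar_A H \<CC> P P)"
proof -
  have T: "T \<in> family" using chain_family_iff[OF ch] P_family by simp
  let ?f = "bar_A_chain H \<CC> P Ts" and ?A = "bar_A H \<CC> P T" and ?B = "bar_A H \<CC> P P"
  note c = bar_A_chain_compare[OF ch]
  have hom: "pull V ` (K \<otimes>\<^bsub>bar_A H \<CC> P V\<^esub> L) = pull V ` K \<otimes>\<^bsub>model\<^esub> pull V ` L"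
    if "V \<in> family" "K \<in> carrier (bar_A H \<CC> P V)" "L \<in> carrier (bar_A H \<CC> P V)" for V K L
    using compare_iso[OF that(1)] that(2,3) unfolding iso_def hom_def by blast
  note closed = monoid.m_closed[OF group.is_monoid[OF comm_group.axioms(2)[OF comm_group_bar_A]]]
  have "?f (K \<otimes>\<^bsub>?A\<^esub> L) = ?f K \<otimes>\<^bsub>?B\<^esub> ?f L" if K: "K \<in> carrier ?A" and L: "L \<in> carrier ?A" for K L
  proof (rule compare_inj[OF P_family])
    note KL = c[OF closed[OF T K L]]
    show "?f (K \<otimes>\<^bsub>?A\<^esub> L) \<in> carrier ?B" "?f K \<otimes>\<^bsub>?B\<^esub> ?f L \<in> carrier ?B"
      by (intro conjunct1[OF KL] closed[OF P_family] conjunct1[OF c[OF K]] conjunct1[OF c[OF L]])+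
    show "pull P ` ?f (K \<otimes>\<^bsub>?A\<^esub> L) = pull P ` (?f K \<otimes>\<^bsub>?B\<^esub> ?f L)"
      by (simp only: conjunct2[OF KL] hom[OF T K L] conjunct2[OF c[OF K]] conjunct2[OF c[OF L]]
          hom[OF P_family conjunct1[OF c[OF K]] conjunct1[OF c[OF L]]])
  qed
  then have "?f \<in> hom ?A ?B"
    using conjunct1[OF c] by (intro homI)
  moreover have "inj_on ?f (carrier ?A)"
  proof (rule inj_onI)
    fix K L assume K: "K \<in> carrier ?A" and L: "L \<in> carrier ?A" and "?f K = ?f L"
    then have "pull T ` K = pull T ` L"
      using conjunct2[OF c[OF K]] conjunct2[OF c[OF L]] by simp
    then show "K = L" by (rule compare_inj[OF T K L])
  qed
  moreover have "?f ` carrier ?A = carrier ?B"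
  proof
    show "carrier ?B \<subseteq> ?f ` carrier ?A"
    proof
      fix L assume L: "L \<in> carrier ?B"
      obtain K where K: "K \<in> carrier ?A" "pull T ` K = pull P ` L"
        using compare_surj[OF T compare_closed[OF P_family L]] .
      have "pull P ` ?f K = pull P ` L"
        using conjunct2[OF c[OF K(1)]] K(2) by simp
      then have "?f K = L"
        by (rule compare_inj[OF P_family conjunct1[OF c[OF K(1)]] L])
      then show "L \<in> ?f ` carrier ?A" using K by blast
    qed
  qed (use conjunct1[OF c] in \<open>simp add: image_subset_iff\<close>)
  ultimately show ?thesis by (simp add: iso_def bij_betw_def)
qed

lemma bar_A_chain_unique:
  assumes "chain H T Ts P" "chain H T Us P" "K \<in> carrier (bar_A H \<CC> P T)"
  shows "bar_A_chain H \<CC> P Us K = bar_A_chain H \<CC> P Ts K"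
proof -
  note c = bar_A_chain_compare[OF assms(1,3)] and d = bar_A_chain_compare[OF assms(2,3)]
  have "pull P ` bar_A_chain H \<CC> P Us K = pull P ` bar_A_chain H \<CC> P Ts K"
    by (simp only: conjunct2[OF c] conjunct2[OF d])
  then show ?thesis
    by (rule compare_inj[OF P_family conjunct1[OF d] conjunct1[OF c]])
qed

section \<open>Classes of rows and the parity axioms\<close>

definition row_sums :: "('a, 'h) bmatrix \<Rightarrow> ('a \<Rightarrow> 'h) \<Rightarrow> 'a set \<Rightarrow> 'h" where
  "row_sums T r = (\<lambda>C\<in>bar_star H \<CC> P T. weight T r C)"

definition row_class :: "('a, 'h) bmatrix \<Rightarrow> ('a \<Rightarrow> 'h) \<Rightarrow> ('a set \<Rightarrow> 'h) set" where
  "row_class T r = bar_proj H \<CC> P T (row_sums T r)"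

lemma bar_P_eq: "bar_P H \<CC> P T g = row_class T (\<lambda>h. form T (g, h))"
  unfolding bar_P_def row_class_def row_sums_def weight_def form_char_def by simp

lemma row_sums_closed:
  assumes T: "T \<in> family" and r: "r \<in> elems T \<rightarrow> carrier H"
  shows "row_sums T r \<in> carrier (formal_sums H (bar_star H \<CC> P T))"
  unfolding formal_sums_bar_star(2)[OF T] row_sums_def
  using weight_closed[OF bar_star_subset[OF T] based_matrixD(2)[OF family_based[OF T]] r] by auto

lemma row_class_closed:
  "T \<in> family \<Longrightarrow> r \<in> elems T \<rightarrow> carrier H \<Longrightarrow> row_class T r \<in> carrier (bar_A H \<CC> P T)"
  unfolding row_class_def by (intro bar_proj_closed row_sums_closed)

lemma row_class_mult:
  assumes T: "T \<in> family" and r: "r \<in> elems T \<rightarrow> carrier H" "r' \<in> elems T \<rightarrow> carrier H"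
  shows "row_class T r \<otimes>\<^bsub>bar_A H \<CC> P T\<^esub> row_class T r' = row_class T (\<lambda>h. r h \<otimes> r' h)"
proof -
  have "row_sums T r \<otimes>\<^bsub>formal_sums H (bar_star H \<CC> P T)\<^esub> row_sums T r' = row_sums T (\<lambda>h. r h \<otimes> r' h)"
    unfolding mult_formal_sums row_sums_def
    using weight_mult[OF bar_star_subset[OF T] based_matrixD(2)[OF family_based[OF T]] r]
    by (intro restrict_ext) simp
  then show ?thesis
    using normal.rcos_sum[OF bar_s_subgroup_normal(2)[OF T] row_sums_closed[OF T r(1)] row_sums_closed[OF T r(2)]]
    by (simp add: row_class_def bar_proj_def bar_A_def)
qed

lemma row_class_cong:
  assumes T: "T \<in> family" and r': "r' \<in> elems T \<rightarrow> carrier H"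
    and eq: "\<And>h. h \<in> elems T \<Longrightarrow> r h = r' h"
  shows "row_class T r = row_class T r'"
  unfolding row_class_def row_sums_def
  using weight_cong[OF bar_star_subset[OF T] based_matrixD(2)[OF family_based[OF T]] r' eq]
  by (intro arg_cong[of _ _ "bar_proj H \<CC> P T"] restrict_ext)

lemma row_class_base:
  assumes T: "T \<in> family"
  shows "row_class T (\<lambda>h. form T (base T, h)) = \<one>\<^bsub>bar_A H \<CC> P T\<^esub>"
proof -
  interpret F: comm_group "formal_sums H (bar_star H \<CC> P T)"
    using formal_sums_bar_star(1)[OF T] .
  have "row_sums T (\<lambda>h. form T (base T, h)) = bar_s H \<CC> P T"
    unfolding row_sums_def bar_s_def
    using weight_base[OF family_based[OF T] bar_star_subset[OF T]] by (intro restrict_ext)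
  moreover have "bar_s H \<CC> P T \<in> bar_s_subgroup H \<CC> P T"
    unfolding bar_s_subgroup_def by (rule generate.incl) simp
  ultimately show ?thesis
    using F.coset_join2[OF bar_s_closed[OF T] bar_s_subgroup_normal(1)[OF T]]
    by (simp add: row_class_def bar_proj_def bar_A_def)
qed

lemma row_class_one:
  assumes T: "T \<in> family"
  shows "row_class T (\<lambda>_. \<one>) = \<one>\<^bsub>bar_A H \<CC> P T\<^esub>"
proof -
  interpret F: comm_group "formal_sums H (bar_star H \<CC> P T)"
    using formal_sums_bar_star(1)[OF T] .
  have "row_sums T (\<lambda>_. \<one>) = \<one>\<^bsub>formal_sums H (bar_star H \<CC> P T)\<^esub>"
    by (simp add: row_sums_def weight_one one_formal_sums)
  then show ?thesis
    using F.coset_join2[OF F.one_closed bar_s_subgroup_normal(1)[OF T]]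
      subgroup.one_closed[OF bar_s_subgroup_normal(1)[OF T]]
    by (simp add: row_class_def bar_proj_def bar_A_def)
qed

text \<open>Axiom (P0) before any chain is chosen, read off in \<open>model\<close>: the weights of
  a surviving row agree.\<close>

lemma compare_bar_P:
  assumes UT: "oper H U T" and T: "T \<in> family" and g: "g \<in> elems U"
  shows "pull T ` bar_P H \<CC> P T g = pull U ` bar_P H \<CC> P U g"
proof -
  have U: "U \<in> family" using family_oper[OF UT] T by simp
  have gT: "g \<in> elems T" using g oper_psubset(1)[OF UT] by blast
  have "pull T (row_sums T (\<lambda>h. form T (g, h))) = pull U (row_sums U (\<lambda>h. form U (g, h)))"
    unfolding pull_def row_sums_def bar_star_eq[OF T] bar_star_eq[OF U]
    using weight_oper[OF UT T _ g] by (intro restrict_ext) simp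
  then show ?thesis
    unfolding bar_P_eq row_class_def
    by (simp only: compare_bar_proj[OF T row_sums_closed[OF T row_closed[OF family_based[OF T] gT]]]
        compare_bar_proj[OF U row_sums_closed[OF U row_closed[OF family_based[OF U] g]]])
qed

text \<open>\<open>F\<close> chooses a chain for each matrix separately, so the chains of the two
  matrices in (P0) are unrelated; the two values are compared through their images in
  \<open>model\<close>.\<close>

lemma bar_parity:
  assumes F: "\<forall>T\<in>family. chain H T (F T) P"
  shows "parity H family (bar_A H \<CC> P P) (\<lambda>T g. bar_A_chain H \<CC> P (F T) (bar_P H \<CC> P T g))"
proof -
  let ?B = "bar_A H \<CC> P P"
  define p where "p T g = bar_A_chain H \<CC> P (F T) (bar_P H \<CC> P T g)" for T g
  \<comment> \<open>\<open>p\<close> extended from rows to arbitrary functions. It is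
    multiplicative, and trivial on the zero row and the row of the base, so (P1), (P2) and (P3) each
    reduce to one of these two rows.\<close>
  define q where "q T r = bar_A_chain H \<CC> P (F T) (row_class T r)" for T r
  have pq: "p T g = q T (\<lambda>h. form T (g, h))" for T g
    by (simp add: p_def q_def bar_P_eq)
  have ch: "chain H T (F T) P" if "T \<in> family" for T
    using F that by blast
  have hom: "bar_A_chain H \<CC> P (F T) \<in> hom (bar_A H \<CC> P T) ?B" if "T \<in> family" for T
    using bar_A_chain_iso[OF ch[OF that]] by (simp add: iso_def)
  have row: "(\<lambda>h. form T (g, h)) \<in> elems T \<rightarrow> carrier H" if "T \<in> family" "g \<in> elems T" for T g
    using row_closed[OF family_based[OF that(1)] that(2)] .
  have closed: "p T g \<in> carrier ?B" if "T \<in> family" "g \<in> elems T" for T g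
    unfolding pq q_def by (rule hom_in_carrier[OF hom row_class_closed[OF that(1) row]]) (use that in auto)
  have mult: "q T r \<otimes>\<^bsub>?B\<^esub> q T r' = q T (\<lambda>h. r h \<otimes> r' h)"
    if "T \<in> family" "r \<in> elems T \<rightarrow> carrier H" "r' \<in> elems T \<rightarrow> carrier H" for T r r'
    unfolding q_def row_class_mult[OF that, symmetric]
    by (rule hom_mult[OF hom[OF that(1)] row_class_closed[OF that(1,2)] row_class_closed[OF that(1,3)], symmetric])
  have one: "bar_A_chain H \<CC> P (F T) \<one>\<^bsub>bar_A H \<CC> P T\<^esub> = \<one>\<^bsub>?B\<^esub>" if "T \<in> family" for T
    by (rule hom_one[OF hom[OF that] comm_group.axioms(2)[OF comm_group_bar_A[OF that]]
          comm_group.axioms(2)[OF comm_group_bar_A[OF P_family]]])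
  have q_base: "q T r = \<one>\<^bsub>?B\<^esub>"
    if T: "T \<in> family" and r: "\<And>h. h \<in> elems T \<Longrightarrow> r h = form T (base T, h)" for T r
    unfolding q_def
    using row_class_cong[OF T row[OF T based_matrixD(2)[OF family_based[OF T]]] r]
    by (simp only: row_class_base[OF T] one[OF T])
  have q_one: "q T r = \<one>\<^bsub>?B\<^esub>"
    if T: "T \<in> family" and r: "\<And>h. h \<in> elems T \<Longrightarrow> r h = \<one>" for T r
  proof -
    have "row_class T r = row_class T (\<lambda>_. \<one>)"
      by (rule row_class_cong[OF T _ r]) auto
    then show ?thesis
      unfolding q_def by (simp only: row_class_one[OF T] one[OF T])
  qed
  have P0: "p T' g = p T g" if T: "T \<in> family" "T' \<in> family" "oper H T T'" and g: "g \<in> elems T" for T T' g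
  proof -
    have g': "g \<in> elems T'" using oper_psubset(1)[OF T(3)] g by blast
    have c: "bar_P H \<CC> P T g \<in> carrier (bar_A H \<CC> P T)" "bar_P H \<CC> P T' g \<in> carrier (bar_A H \<CC> P T')"
      unfolding bar_P_eq using row_class_closed[OF T(1) row[OF T(1) g]] row_class_closed[OF T(2) row[OF T(2) g']] by blast+
    have "pull P ` p T' g = pull P ` p T g"
      unfolding p_def
      by (simp only: conjunct2[OF bar_A_chain_compare[OF ch[OF T(1)] c(1)]]
          conjunct2[OF bar_A_chain_compare[OF ch[OF T(2)] c(2)]] compare_bar_P[OF T(3,2) g])
    then show ?thesis
      by (rule compare_inj[OF P_family closed[OF T(2) g'] closed[OF T(1) g]])
  qed
  have P1: "p T g = \<one>\<^bsub>?B\<^esub>" if T: "T \<in> family" and g: "annihilating H T g \<or> core T g" for T g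
    using g
  proof
    assume "annihilating H T g"
    then show ?thesis unfolding pq by (intro q_one[OF T]) (simp add: annihilating_def)
  next
    assume "core T g"
    then show ?thesis unfolding pq by (intro q_base[OF T]) (simp add: core_def)
  qed
  have P2: "p T g1 \<otimes>\<^bsub>?B\<^esub> p T g2 = \<one>\<^bsub>?B\<^esub>" if T: "T \<in> family" and g: "complementary H T g1 g2" for T g1 g2
  proof -
    have g12: "g1 \<in> elems T" "g2 \<in> elems T"
      using g by (auto simp: complementary_def nonbase_def)
    show ?thesis
      unfolding pq mult[OF T row[OF T g12(1)] row[OF T g12(2)]] using g
      by (intro q_base[OF T]) (simp add: complementary_def)
  qed
  have P3: "p T g1 \<otimes>\<^bsub>?B\<^esub> p T g2 \<otimes>\<^bsub>?B\<^esub> p T g3 = \<one>\<^bsub>?B\<^esub>"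
    if T: "T \<in> family" and g: "g1 \<in> elems T" "g2 \<in> elems T" "g3 \<in> elems T"
      and eq: "\<forall>h\<in>elems T. form T (g1, h) \<otimes> form T (g2, h) \<otimes> form T (g3, h) = form T (base T, h)" for T g1 g2 g3
  proof -
    have r12: "(\<lambda>h. form T (g1, h) \<otimes> form T (g2, h)) \<in> elems T \<rightarrow> carrier H"
      using row[OF T g(1)] row[OF T g(2)] by auto
    show ?thesis
      unfolding pq mult[OF T row[OF T g(1)] row[OF T g(2)]] mult[OF T r12 row[OF T g(3)]]
      using eq by (intro q_base[OF T]) simp
  qed
  have "parity H family ?B p"
    unfolding parity_def
  proof (intro conjI ballI allI impI)
    fix T assume T: "T \<in> family"
    show "p T \<in> elems T \<rightarrow> carrier ?B" using closed[OF T] by blast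
    show "p T (base T) = \<one>\<^bsub>?B\<^esub>" unfolding pq by (rule q_base[OF T]) simp
  next
    fix T g1 g2 g3
    assume T: "T \<in> family" and n: "g1 \<in> nonbase T" "g2 \<in> nonbase T" "g3 \<in> nonbase T"
      and eq: "\<forall>h\<in>elems T. form T (g1, h) \<otimes> form T (g2, h) \<otimes> form T (g3, h) = form T (base T, h)"
    show "p T g1 \<otimes>\<^bsub>?B\<^esub> p T g2 \<otimes>\<^bsub>?B\<^esub> p T g3 = \<one>\<^bsub>?B\<^esub>"
      by (rule P3[OF T _ _ _ eq]) (use n in \<open>simp_all add: nonbase_def\<close>)
  qed (fact comm_group_bar_A[OF P_family] P0 P1 P2)+
  then show ?thesis unfolding p_def .
qed

end

theorem theorem4:
  fixes H :: "('h, 'm) monoid_scheme"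
    and T0 P :: "('a, 'h) bmatrix"
    and \<CC> :: "('a, 'h) bmatrix \<Rightarrow> 'a set set"
  assumes "infinite (UNIV :: 'a set)"
    and "comm_group H"
    and "based_matrix H T0"
    and "tribal_system H (homology_class H T0) \<CC>"
    and "primitive H P"
    and "homologous H T0 P"
  shows "(\<forall>T Ts. chain H T Ts P \<longrightarrow>
            bar_A_chain H \<CC> P Ts \<in> iso (bar_A H \<CC> P T) (bar_A H \<CC> P P) \<and>
            (\<forall>Us. chain H T Us P \<longrightarrow>
               (\<forall>K\<in>carrier (bar_A H \<CC> P T). bar_A_chain H \<CC> P Us K = bar_A_chain H \<CC> P Ts K)))
       \<and> (\<forall>F. (\<forall>T\<in>homology_class H T0. chain H T (F T) P) \<longrightarrow>
            parity H (homology_class H T0) (bar_A H \<CC> P P)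
              (\<lambda>T g. bar_A_chain H \<CC> P (F T) (bar_P H \<CC> P T g)))"
proof -
  interpret primitive_representative H T0 \<CC> P
    by (intro primitive_representative.intro primitive_representative_axioms.intro
        tribal_matrices.intro tribal_matrices_axioms.intro based_matrices.intro assms)
  show ?thesis
    by (intro conjI allI impI ballI bar_A_chain_iso bar_A_chain_unique bar_parity)
      (assumption | erule (1) bspec)+
qed

end
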